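(* Let $(X,* )$ be a quandle, let $(D_X,\rho_{+\leftrightarrow -})$ be the symmetric double of $X$, let $Y$ be an $X$-set, regarded also as a $(D_X,\rho_{+\leftrightarrow -})$-set, and let $A$ be an abelian group. Then for any $n\in\mathbb Z$, \[ (1)\quad H_n^{\rm Q}(X;A)_Y\cong H_n^{\rm SQ}(D_X,\rho_{+\leftrightarrow -};A)_Y \] and \[ (2)\quad H^n_{\rm Q}(X;A)_Y\cong H^n_{\rm SQ}(D_X,\rho_{+\leftrightarrow -};A)_Y . \]
   Context: Quandles. A quandle $(X,* )$ is a set $X$ with a binary operation $*$ such that (Q1) $x*x=x$; (Q2) for all $x,y\in X$ there is a unique $z\in X$ with $z*y=x$, denoted $z=x*y^{-1}$; (Q3) $(x*y)*z=(x*z)*(y*z)$. Write $x*y^{+1}=x*y$. A good involution of $X$ is an involution $\rho:X\to X$ with $\rho(x*y)=\rho(x)*y$ and $x*\rho(y)=x*y^{-1}$ for all $x,y$; the pair $(X,\rho)$ is then a symmetric quandle. Symmetric double. For a quandle $(X,* )$, let $X^{\varepsilon}=\{x^{\varepsilon}\mid x\in X\}$ ($\varepsilon\in\{\pm1\}$) be two copies of $X$ and $D_X=X^{+1}\sqcup X^{-1}$, with operation $x^{\varepsilon}\star y^{\delta}=(x*y^{\delta})^{\varepsilon}$ and involution $\rho_{+\leftrightarrow -}(x^{\varepsilon})=x^{-\varepsilon}$. Then $(D_X,\rho_{+\leftrightarrow -})$ is a symmetric quandle, called the symmetric double of $X$. Sets with action. $G_X=\langle x\in X\mid x*y=y^{-1}xy\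 (x,y\in X)\rangle$; an $X$-set is a set $Y$ with a right action of $G_X$, written $r*g$. For a symmetric quandle, $G_{(X,\rho)}=\langle x\in X\mid x*y=y^{-1}xy,\ \rho(x)=x^{-1}\ (x,y\in X)\rangle$; an $(X,\rho)$-set is a set with a right action of $G_{(X,\rho)}$ (in particular it is an $X$-set). An $X$-set $Y$ is a $(D_X,\rho_{+\leftrightarrow -})$-set via $r\star g=r*\pi(g)$, where $\pi:G_{(D_X,\rho_{+\leftrightarrow -})}\to G_X$ is the homomorphism sending the generator $x^{\varepsilon}$ to $x^{\varepsilon}\in G_X$ (i.e. $x$ or its inverse). Chain complexes. For a quandle $X$ and an $X$-set $Y$, $C_n(X)_Y$ is the free abelian group on $Y\times X^n$ if $n\ge 1$ and $0$ otherwise. The boundary is \[\partial_n(r,x_1,\ldots,x_n)=\sum_{i=1}^n(-1)^i\{(r,x_1,\ldots,\hat{x_i},\ldots,x_n)-(r*x_i,x_1*x_i,\ldots,x_{i-1}*x_i,\hat{x_i},x_{i+1},\ldots,x_n)\}\] for $n>1$ (where $\hat{x_i}$ means $x_i$ is removed) and $\partial_n=0$ otherwise. $D_n(X)_Y$ is the subgroup generated by the tuples $(r,x_1,\ldots,x_n)$ with $x_i=x_{i+1}$ for some $i\in\{1,\dots,n-1\}$. Put $C_n^{\rm Q}(X)_Y=C_n(X)_Y/D_n(X)_Y$ with induced boundary $\partial^{\rm Q}_n$. For a symmetric quandle $(X,\rho)$ and an $(X,\rho)$-set $Y$, $D_n(X,\rho)_Y\subset C_n(X)_Y$ is the subgroup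 generated by all elements $(r,x_1,\ldots,x_n)+(r*x_i,x_1*x_i,\ldots,x_{i-1}*x_i,\rho(x_i),x_{i+1},\ldots,x_n)$, $1\le i\le n$. Put $C_n^{\rm SQ}(X,\rho)_Y=C_n(X)_Y/(D_n(X)_Y+D_n(X,\rho)_Y)$ with induced boundary $\partial^{\rm SQ}_n$. (Co)homology. $H_*^{\rm Q}(X;A)_Y$ and $H_*^{\rm SQ}(X,\rho;A)_Y$ are the homology groups of the chain complexes $C_*^{\rm Q}(X)_Y\otimes A$ and $C_*^{\rm SQ}(X,\rho)_Y\otimes A$. $H^*_{\rm Q}(X;A)_Y$ and $H^*_{\rm SQ}(X,\rho;A)_Y$ are the cohomology groups of the cochain complexes ${\rm Hom}(C_n^{\rm Q}(X)_Y,A)$ and ${\rm Hom}(C_n^{\rm SQ}(X,\rho)_Y,A)$ with coboundary $\delta^n(\theta)=\theta\circ\partial_{n+1}$. *)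

theory Defs
  imports "HOL-Algebra.Free_Abelian_Groups"
begin

section \<open>Quandles and symmetric quandles\<close>

datatype sign = Pos | Neg

fun flip :: "sign \<Rightarrow> sign" where
  "flip Pos = Neg"
| "flip Neg = Pos"

fun sign_mult :: "sign \<Rightarrow> sign \<Rightarrow> sign" where
  "sign_mult Pos d = d"
| "sign_mult Neg d = flip d"

locale quandle =
  fixes X :: "'x set" and qop :: "'x \<Rightarrow> 'x \<Rightarrow> 'x"
  assumes closed: "\<lbrakk>x \<in> X; y \<in> X\<rbrakk> \<Longrightarrow> qop x y \<in> X"
    and Q1: "x \<in> X \<Longrightarrow> qop x x = x"
    and Q2: "\<lbrakk>x \<in> X; y \<in> X\<rbrakk> \<Longrightarrow> \<exists>!z. z \<in> X \<and> qop z y = x"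
    and Q3: "\<lbrakk>x \<in> X; y \<in> X; z \<in> X\<rbrakk> \<Longrightarrow> qop (qop x y) z = qop (qop x z) (qop y z)"

text \<open>The element \<open>x * y\<^sup>-\<^sup>1\<close>, and \<open>x * y\<^sup>\<epsilon>\<close> for a sign \<open>\<epsilon>\<close>.\<close>

definition qop_inv :: "'x set \<Rightarrow> ('x \<Rightarrow> 'x \<Rightarrow> 'x) \<Rightarrow> 'x \<Rightarrow> 'x \<Rightarrow> 'x" where
  "qop_inv X qop x y = (THE z. z \<in> X \<and> qop z y = x)"

fun signed_op :: "'x set \<Rightarrow> ('x \<Rightarrow> 'x \<Rightarrow> 'x) \<Rightarrow> 'x \<Rightarrow> 'x \<Rightarrow> sign \<Rightarrow> 'x" where
  "signed_op X qop x y Pos = qop x y"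
| "signed_op X qop x y Neg = qop_inv X qop x y"

locale symmetric_quandle = quandle X qop
  for X :: "'x set" and qop :: "'x \<Rightarrow> 'x \<Rightarrow> 'x" +
  fixes \<rho> :: "'x \<Rightarrow> 'x"
  assumes rho_closed: "x \<in> X \<Longrightarrow> \<rho> x \<in> X"
    and rho_invol: "x \<in> X \<Longrightarrow> \<rho> (\<rho> x) = x"
    and rho_left: "\<lbrakk>x \<in> X; y \<in> X\<rbrakk> \<Longrightarrow> \<rho> (qop x y) = qop (\<rho> x) y"
    and rho_right: "\<lbrakk>x \<in> X; y \<in> X\<rbrakk> \<Longrightarrow> qop x (\<rho> y) = qop_inv X qop x y"

text \<open>The symmetric double; the pair \<open>(x, \<epsilon>)\<close> stands for \<open>x\<^sup>\<epsilon>\<close>.\<close>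

definition double :: "'x set \<Rightarrow> ('x \<times> sign) set" where
  "double X = X \<times> UNIV"

fun double_op :: "'x set \<Rightarrow> ('x \<Rightarrow> 'x \<Rightarrow> 'x) \<Rightarrow> 'x \<times> sign \<Rightarrow> 'x \<times> sign \<Rightarrow> 'x \<times> sign" where
  "double_op X qop (x, e) (y, d) = (signed_op X qop x y d, e)"

fun double_inv :: "'x \<times> sign \<Rightarrow> 'x \<times> sign" where
  "double_inv (x, e) = (x, flip e)"

section \<open>Groups given by a presentation\<close>

text \<open>
  A word over a generating set \<open>S\<close> is a list of letters \<open>(s, \<epsilon>)\<close>, standing for \<open>s\<^sup>\<epsilon>\<close>. The group
  with generators \<open>S\<close> and defining relations \<open>p = q\<close> for \<open>(p, q) \<in> R\<close> consists of the classes of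
  words modulo the least congruence containing \<open>R\<close> and the free cancellations.
\<close>

type_synonym 'g word = "('g \<times> sign) list"

definition words :: "'g set \<Rightarrow> 'g word set" where
  "words S = lists (S \<times> UNIV)"

inductive word_eq :: "'g set \<Rightarrow> ('g word \<times> 'g word) set \<Rightarrow> 'g word \<Rightarrow> 'g word \<Rightarrow> bool"
  for S R where
  refl: "w \<in> words S \<Longrightarrow> word_eq S R w w"
| sym: "word_eq S R v w \<Longrightarrow> word_eq S R w v"
| trans: "\<lbrakk>word_eq S R u v; word_eq S R v w\<rbrakk> \<Longrightarrow> word_eq S R u w"
| cancel: "\<lbrakk>u \<in> words S; v \<in> words S; s \<in> S\<rbrakk>
    \<Longrightarrow> word_eq S R (u @ [(s, e), (s, flip e)] @ v) (u @ v)"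
| rel: "\<lbrakk>u \<in> words S; v \<in> words S; (p, q) \<in> R\<rbrakk> \<Longrightarrow> word_eq S R (u @ p @ v) (u @ q @ v)"

definition word_class :: "'g set \<Rightarrow> ('g word \<times> 'g word) set \<Rightarrow> 'g word \<Rightarrow> 'g word set" where
  "word_class S R w = {v. word_eq S R w v}"

definition presented_group ::
  "'g set \<Rightarrow> ('g word \<times> 'g word) set \<Rightarrow> 'g word set monoid" where
  "presented_group S R =
     \<lparr>carrier = word_class S R ` words S,
      monoid.mult = (\<lambda>a b. \<Union>u\<in>a. \<Union>v\<in>b. word_class S R (u @ v)),
      one = word_class S R []\<rparr>"

definition pres_gen :: "'g set \<Rightarrow> ('g word \<times> 'g word) set \<Rightarrow> 'g \<Rightarrow> 'g word set" where
  "pres_gen S R s = word_class S R [(s, Pos)]"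

text \<open>
  The homomorphism into \<open>presented_group T Q\<close> that sends each generator \<open>s\<close> to the class of the
  single letter \<open>f s\<close>.
\<close>

definition letter_map :: "('g \<Rightarrow> 'h \<times> sign) \<Rightarrow> 'g word \<Rightarrow> 'h word" where
  "letter_map f = map (\<lambda>(s, e). (fst (f s), sign_mult (snd (f s)) e))"

definition pres_hom ::
  "'h set \<Rightarrow> ('h word \<times> 'h word) set \<Rightarrow> ('g \<Rightarrow> 'h \<times> sign) \<Rightarrow> 'g word set \<Rightarrow> 'h word set" where
  "pres_hom T Q f a = (\<Union>w\<in>a. word_class T Q (letter_map f w))"

section \<open>Associated groups and sets with action\<close>

definition quandle_rels :: "'x set \<Rightarrow> ('x \<Rightarrow> 'x \<Rightarrow> 'x) \<Rightarrow> ('x word \<times> 'x word) set" where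
  "quandle_rels X qop =
     {([(qop x y, Pos)], [(y, Neg), (x, Pos), (y, Pos)]) | x y. x \<in> X \<and> y \<in> X}"

definition symm_rels ::
  "'x set \<Rightarrow> ('x \<Rightarrow> 'x \<Rightarrow> 'x) \<Rightarrow> ('x \<Rightarrow> 'x) \<Rightarrow> ('x word \<times> 'x word) set" where
  "symm_rels X qop \<rho> = quandle_rels X qop \<union> {([(\<rho> x, Pos)], [(x, Neg)]) | x. x \<in> X}"

definition assoc_group :: "'x set \<Rightarrow> ('x \<Rightarrow> 'x \<Rightarrow> 'x) \<Rightarrow> 'x word set monoid" where
  "assoc_group X qop = presented_group X (quandle_rels X qop)"

definition symm_assoc_group ::
  "'x set \<Rightarrow> ('x \<Rightarrow> 'x \<Rightarrow> 'x) \<Rightarrow> ('x \<Rightarrow> 'x) \<Rightarrow> 'x word set monoid" where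
  "symm_assoc_group X qop \<rho> = presented_group X (symm_rels X qop \<rho>)"

locale right_action =
  fixes G :: "('g, 'm) monoid_scheme" (structure) and Y :: "'y set" and act :: "'y \<Rightarrow> 'g \<Rightarrow> 'y"
  assumes group: "group G"
    and act_closed: "\<lbrakk>r \<in> Y; g \<in> carrier G\<rbrakk> \<Longrightarrow> act r g \<in> Y"
    and act_one: "r \<in> Y \<Longrightarrow> act r \<one> = r"
    and act_mult: "\<lbrakk>r \<in> Y; g \<in> carrier G; h \<in> carrier G\<rbrakk> \<Longrightarrow> act r (g \<otimes> h) = act (act r g) h"

abbreviation quandle_set ::
  "'x set \<Rightarrow> ('x \<Rightarrow> 'x \<Rightarrow> 'x) \<Rightarrow> 'y set \<Rightarrow> ('y \<Rightarrow> 'x word set \<Rightarrow> 'y) \<Rightarrow> bool" where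
  "quandle_set X qop Y act \<equiv> right_action (assoc_group X qop) Y act"

abbreviation symm_quandle_set ::
  "'x set \<Rightarrow> ('x \<Rightarrow> 'x \<Rightarrow> 'x) \<Rightarrow> ('x \<Rightarrow> 'x) \<Rightarrow> 'y set \<Rightarrow> ('y \<Rightarrow> 'x word set \<Rightarrow> 'y) \<Rightarrow> bool" where
  "symm_quandle_set X qop \<rho> Y act \<equiv> right_action (symm_assoc_group X qop \<rho>) Y act"

text \<open>
  A set with an action of the symmetric associated group is a set with an action of the associated
  group, along the canonical projection that sends each generator to itself.
\<close>

definition underlying_act ::
  "'x set \<Rightarrow> ('x \<Rightarrow> 'x \<Rightarrow> 'x) \<Rightarrow> ('x \<Rightarrow> 'x) \<Rightarrow> ('y \<Rightarrow> 'x word set \<Rightarrow> 'y) \<Rightarrow> 'y \<Rightarrow> 'x word set \<Rightarrow> 'y"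
  where
  "underlying_act X qop \<rho> act r g = act r (pres_hom X (symm_rels X qop \<rho>) (\<lambda>x. (x, Pos)) g)"

text \<open>
  The homomorphism \<open>\<pi>\<close> sending the generator \<open>x\<^sup>\<epsilon>\<close> to the group element \<open>x\<^sup>\<epsilon>\<close>: a generator
  \<open>(x, \<epsilon>)\<close> of the symmetric associated group of the double is at the same time a letter of a word
  over \<open>X\<close>, which is why the letter assignment is the identity function.
\<close>

definition double_proj ::
  "'x set \<Rightarrow> ('x \<Rightarrow> 'x \<Rightarrow> 'x) \<Rightarrow> ('x \<times> sign) word set \<Rightarrow> 'x word set" where
  "double_proj X qop = pres_hom X (quandle_rels X qop) id"

definition double_act ::
  "'x set \<Rightarrow> ('x \<Rightarrow> 'x \<Rightarrow> 'x) \<Rightarrow> ('y \<Rightarrow> 'x word set \<Rightarrow> 'y)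
    \<Rightarrow> 'y \<Rightarrow> ('x \<times> sign) word set \<Rightarrow> 'y" where
  "double_act X qop act r g = act r (double_proj X qop g)"

section \<open>Homological algebra\<close>

text \<open>
  A chain complex is given by groups \<open>C n\<close> and homomorphisms \<open>d n\<close> from \<open>C n\<close> to \<open>C (n - 1)\<close>; in a
  cochain complex \<open>d n\<close> goes from \<open>C n\<close> to \<open>C (n + 1)\<close>. The map \<open>G / N \<rightarrow> H / M\<close> induced by a
  homomorphism \<open>f\<close> with \<open>f ` N \<subseteq> M\<close> is \<open>quot_map H M f\<close>.
\<close>

definition quot_map ::
  "('b, 'm) monoid_scheme \<Rightarrow> 'b set \<Rightarrow> ('a \<Rightarrow> 'b) \<Rightarrow> 'a set \<Rightarrow> 'b set" where
  "quot_map H M f K = (\<Union>x\<in>K. M #>\<^bsub>H\<^esub> f x)"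

definition homology ::
  "(int \<Rightarrow> ('a, 'm) monoid_scheme) \<Rightarrow> (int \<Rightarrow> 'a \<Rightarrow> 'a) \<Rightarrow> int \<Rightarrow> 'a set monoid" where
  "homology C d n =
     (C n)\<lparr>carrier := kernel (C n) (C (n - 1)) (d n)\<rparr> Mod (d (n + 1) ` carrier (C (n + 1)))"

definition cohomology ::
  "(int \<Rightarrow> ('a, 'm) monoid_scheme) \<Rightarrow> (int \<Rightarrow> 'a \<Rightarrow> 'a) \<Rightarrow> int \<Rightarrow> 'a set monoid" where
  "cohomology C d n =
     (C n)\<lparr>carrier := kernel (C n) (C (n + 1)) (d n)\<rparr> Mod (d (n - 1) ` carrier (C (n - 1)))"

text \<open>The tensor product over the integers of abelian groups (written multiplicatively).\<close>

definition tensor_rels ::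
  "('a, 'm) monoid_scheme \<Rightarrow> ('b, 'n) monoid_scheme \<Rightarrow> ('a \<times> 'b \<Rightarrow>\<^sub>0 int) set" where
  "tensor_rels G A =
     {frag_of (g \<otimes>\<^bsub>G\<^esub> h, a) - (frag_of (g, a) + frag_of (h, a)) | g h a.
        g \<in> carrier G \<and> h \<in> carrier G \<and> a \<in> carrier A} \<union>
     {frag_of (g, a \<otimes>\<^bsub>A\<^esub> b) - (frag_of (g, a) + frag_of (g, b)) | g a b.
        g \<in> carrier G \<and> a \<in> carrier A \<and> b \<in> carrier A}"

definition tensor_kernel ::
  "('a, 'm) monoid_scheme \<Rightarrow> ('b, 'n) monoid_scheme \<Rightarrow> ('a \<times> 'b \<Rightarrow>\<^sub>0 int) set" where
  "tensor_kernel G A =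
     generate (free_Abelian_group (carrier G \<times> carrier A)) (tensor_rels G A)"

definition tensor ::
  "('a, 'm) monoid_scheme \<Rightarrow> ('b, 'n) monoid_scheme \<Rightarrow> ('a \<times> 'b \<Rightarrow>\<^sub>0 int) set monoid" where
  "tensor G A = free_Abelian_group (carrier G \<times> carrier A) Mod tensor_kernel G A"

text \<open>The homomorphism \<open>f \<otimes> id\<close> with values in \<open>tensor H A\<close>.\<close>

definition tensor_map ::
  "('c, 'm) monoid_scheme \<Rightarrow> ('b, 'n) monoid_scheme \<Rightarrow> ('a \<Rightarrow> 'c)
    \<Rightarrow> ('a \<times> 'b \<Rightarrow>\<^sub>0 int) set \<Rightarrow> ('c \<times> 'b \<Rightarrow>\<^sub>0 int) set" where
  "tensor_map H A f =
     quot_map (free_Abelian_group (carrier H \<times> carrier A)) (tensor_kernel H A)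
       (frag_extend (\<lambda>(g, a). frag_of (f g, a)))"

definition homology_coeff ::
  "(int \<Rightarrow> ('a, 'm) monoid_scheme) \<Rightarrow> (int \<Rightarrow> 'a \<Rightarrow> 'a) \<Rightarrow> ('b, 'n) monoid_scheme \<Rightarrow> int
    \<Rightarrow> ('a \<times> 'b \<Rightarrow>\<^sub>0 int) set set monoid" where
  "homology_coeff C d A n =
     homology (\<lambda>k. tensor (C k) A) (\<lambda>k. tensor_map (C (k - 1)) A (d k)) n"

text \<open>Homomorphisms are taken extensional so that they form a group under pointwise multiplication.\<close>

definition Hom_group ::
  "('a, 'm) monoid_scheme \<Rightarrow> ('b, 'n) monoid_scheme \<Rightarrow> ('a \<Rightarrow> 'b) monoid" where
  "Hom_group G A =
     \<lparr>carrier = hom G A \<inter> extensional (carrier G),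
      monoid.mult = (\<lambda>f g. \<lambda>x\<in>carrier G. f x \<otimes>\<^bsub>A\<^esub> g x),
      one = (\<lambda>x\<in>carrier G. \<one>\<^bsub>A\<^esub>)\<rparr>"

definition cohomology_coeff ::
  "(int \<Rightarrow> ('a, 'm) monoid_scheme) \<Rightarrow> (int \<Rightarrow> 'a \<Rightarrow> 'a) \<Rightarrow> ('b, 'n) monoid_scheme \<Rightarrow> int
    \<Rightarrow> ('a \<Rightarrow> 'b) set monoid" where
  "cohomology_coeff C d A n =
     cohomology (\<lambda>k. Hom_group (C k) A)
       (\<lambda>k \<theta>. restrict (\<theta> \<circ> d (k + 1)) (carrier (C (k + 1)))) n"

section \<open>Quandle and symmetric quandle (co)homology\<close>

text \<open>
  The generator \<open>(r, x\<^sub>1, \<dots>, x\<^sub>n)\<close> is \<open>(r, xs)\<close> with \<open>length xs = n\<close>; list positions start at \<open>0\<close>,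
  so the position \<open>i\<close> below corresponds to the index \<open>i + 1\<close>.
\<close>

definition chain_basis :: "'x set \<Rightarrow> 'y set \<Rightarrow> int \<Rightarrow> ('y \<times> 'x list) set" where
  "chain_basis X Y n = (if n \<ge> 1 then Y \<times> {xs. set xs \<subseteq> X \<and> int (length xs) = n} else {})"

definition chain_group :: "'x set \<Rightarrow> 'y set \<Rightarrow> int \<Rightarrow> ('y \<times> 'x list \<Rightarrow>\<^sub>0 int) monoid" where
  "chain_group X Y n = free_Abelian_group (chain_basis X Y n)"

definition gen_act ::
  "'x set \<Rightarrow> ('x \<Rightarrow> 'x \<Rightarrow> 'x) \<Rightarrow> ('y \<Rightarrow> 'x word set \<Rightarrow> 'y) \<Rightarrow> 'y \<Rightarrow> 'x \<Rightarrow> 'y" where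
  "gen_act X qop act r x = act r (pres_gen X (quandle_rels X qop) x)"

definition bdry ::
  "'x set \<Rightarrow> ('x \<Rightarrow> 'x \<Rightarrow> 'x) \<Rightarrow> ('y \<Rightarrow> 'x word set \<Rightarrow> 'y) \<Rightarrow> int
    \<Rightarrow> ('y \<times> 'x list \<Rightarrow>\<^sub>0 int) \<Rightarrow> ('y \<times> 'x list \<Rightarrow>\<^sub>0 int)" where
  "bdry X qop act n =
     (if n > 1 then
        frag_extend (\<lambda>(r, xs). \<Sum>i<length xs. frag_cmul ((-1) ^ (i + 1))
          (frag_of (r, take i xs @ drop (i + 1) xs)
           - frag_of (gen_act X qop act r (xs ! i),
               map (\<lambda>x. qop x (xs ! i)) (take i xs) @ drop (i + 1) xs)))
      else (\<lambda>_. 0))"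

definition degen :: "'x set \<Rightarrow> 'y set \<Rightarrow> int \<Rightarrow> ('y \<times> 'x list \<Rightarrow>\<^sub>0 int) set" where
  "degen X Y n = generate (chain_group X Y n)
     {frag_of (r, xs) | r xs. (r, xs) \<in> chain_basis X Y n \<and>
        (\<exists>i. i + 1 < length xs \<and> xs ! i = xs ! (i + 1))}"

definition symm_degen ::
  "'x set \<Rightarrow> ('x \<Rightarrow> 'x \<Rightarrow> 'x) \<Rightarrow> ('x \<Rightarrow> 'x) \<Rightarrow> 'y set \<Rightarrow> ('y \<Rightarrow> 'x word set \<Rightarrow> 'y) \<Rightarrow> int
    \<Rightarrow> ('y \<times> 'x list \<Rightarrow>\<^sub>0 int) set" where
  "symm_degen X qop \<rho> Y act n = generate (chain_group X Y n)
     {frag_of (r, xs)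
      + frag_of (gen_act X qop act r (xs ! i),
          map (\<lambda>x. qop x (xs ! i)) (take i xs) @ [\<rho> (xs ! i)] @ drop (i + 1) xs) | r xs i.
        (r, xs) \<in> chain_basis X Y n \<and> i < length xs}"

definition CQ :: "'x set \<Rightarrow> 'y set \<Rightarrow> int \<Rightarrow> ('y \<times> 'x list \<Rightarrow>\<^sub>0 int) set monoid" where
  "CQ X Y n = chain_group X Y n Mod degen X Y n"

definition bdryQ ::
  "'x set \<Rightarrow> ('x \<Rightarrow> 'x \<Rightarrow> 'x) \<Rightarrow> 'y set \<Rightarrow> ('y \<Rightarrow> 'x word set \<Rightarrow> 'y) \<Rightarrow> int
    \<Rightarrow> ('y \<times> 'x list \<Rightarrow>\<^sub>0 int) set \<Rightarrow> ('y \<times> 'x list \<Rightarrow>\<^sub>0 int) set" where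
  "bdryQ X qop Y act n =
     quot_map (chain_group X Y (n - 1)) (degen X Y (n - 1)) (bdry X qop act n)"

text \<open>
  For the symmetric quandle complex, \<open>act\<close> is an action of the symmetric associated group; chains
  and boundary are those of the underlying set with an action of the associated group.
\<close>

definition SQ_degen ::
  "'x set \<Rightarrow> ('x \<Rightarrow> 'x \<Rightarrow> 'x) \<Rightarrow> ('x \<Rightarrow> 'x) \<Rightarrow> 'y set \<Rightarrow> ('y \<Rightarrow> 'x word set \<Rightarrow> 'y) \<Rightarrow> int
    \<Rightarrow> ('y \<times> 'x list \<Rightarrow>\<^sub>0 int) set" where
  "SQ_degen X qop \<rho> Y act n =
     degen X Y n <#>\<^bsub>chain_group X Y n\<^esub> symm_degen X qop \<rho> Y (underlying_act X qop \<rho> act) n"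

definition CSQ ::
  "'x set \<Rightarrow> ('x \<Rightarrow> 'x \<Rightarrow> 'x) \<Rightarrow> ('x \<Rightarrow> 'x) \<Rightarrow> 'y set \<Rightarrow> ('y \<Rightarrow> 'x word set \<Rightarrow> 'y) \<Rightarrow> int
    \<Rightarrow> ('y \<times> 'x list \<Rightarrow>\<^sub>0 int) set monoid" where
  "CSQ X qop \<rho> Y act n = chain_group X Y n Mod SQ_degen X qop \<rho> Y act n"

definition bdrySQ ::
  "'x set \<Rightarrow> ('x \<Rightarrow> 'x \<Rightarrow> 'x) \<Rightarrow> ('x \<Rightarrow> 'x) \<Rightarrow> 'y set \<Rightarrow> ('y \<Rightarrow> 'x word set \<Rightarrow> 'y) \<Rightarrow> int
    \<Rightarrow> ('y \<times> 'x list \<Rightarrow>\<^sub>0 int) set \<Rightarrow> ('y \<times> 'x list \<Rightarrow>\<^sub>0 int) set" where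
  "bdrySQ X qop \<rho> Y act n =
     quot_map (chain_group X Y (n - 1)) (SQ_degen X qop \<rho> Y act (n - 1))
       (bdry X qop (underlying_act X qop \<rho> act) n)"

definition HQ_lower where
  "HQ_lower X qop Y act A n = homology_coeff (CQ X Y) (bdryQ X qop Y act) A n"

definition HSQ_lower where
  "HSQ_lower X qop \<rho> Y act A n =
     homology_coeff (CSQ X qop \<rho> Y act) (bdrySQ X qop \<rho> Y act) A n"

definition HQ_upper where
  "HQ_upper X qop Y act A n = cohomology_coeff (CQ X Y) (bdryQ X qop Y act) A n"

definition HSQ_upper where
  "HSQ_upper X qop \<rho> Y act A n =
     cohomology_coeff (CSQ X qop \<rho> Y act) (bdrySQ X qop \<rho> Y act) A n"

section \<open>The symmetric double and its action are well defined\<close>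

lemma flip_flip [simp]: "flip (flip e) = e"
  by (cases e) auto

lemma (in quandle) qop_inv:
  assumes "x \<in> X" "y \<in> X"
  shows qop_inv_closed: "qop_inv X qop x y \<in> X"
    and qop_qop_inv: "qop (qop_inv X qop x y) y = x"
  using theI'[OF Q2[OF assms]] unfolding qop_inv_def by auto

lemma (in quandle) qop_inv_eqI:
  assumes "z \<in> X" "y \<in> X" "qop z y = x"
  shows "qop_inv X qop x y = z"
  using Q2[of x y] qop_inv_closed[of x y] qop_qop_inv[of x y] closed assms by blast

lemma (in quandle) signed_op_closed:
  "\<lbrakk>x \<in> X; y \<in> X\<rbrakk> \<Longrightarrow> signed_op X qop x y e \<in> X"
  by (cases e) (auto simp: closed qop_inv_closed)

lemma (in quandle) signed_op_flip:
  "\<lbrakk>x \<in> X; y \<in> X\<rbrakk> \<Longrightarrow> signed_op X qop (signed_op X qop x y (flip e)) y e = x"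
  by (cases e) (auto simp: qop_qop_inv closed intro: qop_inv_eqI)

lemma (in quandle) signed_op_unique:
  "\<lbrakk>x \<in> X; y \<in> X; z \<in> X\<rbrakk> \<Longrightarrow> signed_op X qop z y e = x \<longleftrightarrow> z = signed_op X qop x y (flip e)"
  using signed_op_flip[of x y e] signed_op_flip[of z y "flip e"] by auto

lemma (in quandle) signed_op_distrib_pos:
  assumes "x \<in> X" "y \<in> X" "z \<in> X"
  shows "signed_op X qop (qop x y) z e = qop (signed_op X qop x z e) (signed_op X qop y z e)"
proof (cases e)
  case Neg
  let ?x = "qop_inv X qop x z" and ?y = "qop_inv X qop y z"
  have "qop (qop ?x ?y) z = qop x y"
    using assms by (simp add: Q3 qop_inv_closed qop_qop_inv)
  then show ?thesis
    using Neg assms by (auto simp: closed qop_inv_closed intro!: qop_inv_eqI)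
qed (use assms Q3 in auto)

lemma (in quandle) signed_op_distrib:
  assumes "x \<in> X" "y \<in> X" "z \<in> X"
  shows "signed_op X qop (signed_op X qop x y d) z e =
    signed_op X qop (signed_op X qop x z e) (signed_op X qop y z e) d"
proof (cases d)
  case Neg
  have "qop (signed_op X qop (qop_inv X qop x y) z e) (signed_op X qop y z e) = signed_op X qop x z e"
    using assms signed_op_distrib_pos[of "qop_inv X qop x y" y z e]
    by (simp add: qop_inv_closed qop_qop_inv)
  then show ?thesis
    using Neg assms by (auto simp: signed_op_closed qop_inv_closed intro!: qop_inv_eqI[symmetric])
qed (use assms signed_op_distrib_pos in auto)

lemma (in quandle) double_quandle: "quandle (double X) (double_op X qop)"
proof (unfold_locales, goal_cases)
  case (1 a b) then show ?case
    by (cases a; cases b) (auto simp: double_def signed_op_closed)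
next
  case (2 a)
  then have "signed_op X qop (fst a) (fst a) (snd a) = fst a"
    using Q1 by (cases "snd a") (auto simp: double_def intro: qop_inv_eqI)
  then show ?case by (cases a) auto
next
  case (3 a b)
  obtain x e y d where ab: "a = (x, e)" "b = (y, d)" by (cases a; cases b) auto
  with 3 have xy: "x \<in> X" "y \<in> X" by (auto simp: double_def)
  have "c \<in> double X \<and> double_op X qop c b = a \<longleftrightarrow> c = (signed_op X qop x y (flip d), e)" for c
    using xy signed_op_unique[of x y "fst c" d] ab
    by (cases c) (auto simp: double_def signed_op_closed)
  then show ?case by auto
next
  case (4 a b c)
  then show ?case
    by (cases a; cases b; cases c) (auto simp: double_def signed_op_distrib)
qed

lemma (in quandle) double_symmetric_quandle:
  "symmetric_quandle (double X) (double_op X qop) double_inv"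
proof (intro symmetric_quandle.intro symmetric_quandle_axioms.intro double_quandle)
  show "double_op X qop a (double_inv b) = qop_inv (double X) (double_op X qop) a b"
    if "a \<in> double X" "b \<in> double X" for a b
  proof -
    have "double_op X qop (double_op X qop a (double_inv b)) b = a"
      using that signed_op_flip[of "fst a" "fst b" "snd b"]
      by (cases a; cases b) (auto simp: double_def)
    moreover have "double_op X qop a (double_inv b) \<in> double X"
      using that by (cases a; cases b) (auto simp: double_def signed_op_closed)
    ultimately show ?thesis
      using that quandle.qop_inv_eqI[OF double_quandle] by metis
  qed
qed (auto simp: double_def)

lemma words_simps [simp]:
  "[] \<in> words S" "(s, e) # w \<in> words S \<longleftrightarrow> s \<in> S \<and> w \<in> words S"
  "u @ v \<in> words S \<longleftrightarrow> u \<in> words S \<and> v \<in> words S"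
  by (auto simp: words_def)

context
  fixes S :: "'g set" and R
  assumes R: "R \<subseteq> words S \<times> words S"
begin

lemma word_eq_words: "word_eq S R u v \<Longrightarrow> u \<in> words S \<and> v \<in> words S"
  by (induction rule: word_eq.induct) (use R in auto)

lemma word_eq_ctxt:
  assumes "word_eq S R v w" "a \<in> words S" "b \<in> words S"
  shows "word_eq S R (a @ v @ b) (a @ w @ b)"
  using assms
proof (induction rule: word_eq.induct)
  case (refl w) then show ?case by (simp add: word_eq.refl)
next
  case (sym v w) then show ?case by (blast intro: word_eq.sym)
next
  case (trans u v w) then show ?case by (meson word_eq.trans)
next
  case (cancel u v s e)
  then show ?case using word_eq.cancel[of "a @ u" S "v @ b" s R e] by simp
next
  case (rel u v p q)
  then show ?case using word_eq.rel[of "a @ u" S "v @ b" p q R] by simp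
qed

lemma word_eq_append:
  assumes "word_eq S R u u'" "word_eq S R v v'"
  shows "word_eq S R (u @ v) (u' @ v')"
proof -
  have "word_eq S R (u @ v) (u' @ v)"
    using word_eq_ctxt[OF assms(1), of "[]" v] word_eq_words[OF assms(2)] by simp
  moreover have "word_eq S R (u' @ v) (u' @ v')"
    using word_eq_ctxt[OF assms(2), of u' "[]"] word_eq_words[OF assms(1)] by simp
  ultimately show ?thesis by (rule word_eq.trans)
qed

lemma word_class_eq: "word_eq S R u v \<Longrightarrow> word_class S R u = word_class S R v"
  unfolding word_class_def
  using word_eq.trans[of S R u v] word_eq.trans[OF word_eq.sym, of S R u v] by blast

lemma word_class_mult:
  assumes "u \<in> words S" "v \<in> words S"
  shows "word_class S R u \<otimes>\<^bsub>presented_group S R\<^esub> word_class S R v = word_class S R (u @ v)"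
proof -
  have "word_class S R (u' @ v') = word_class S R (u @ v)"
    if "u' \<in> word_class S R u" "v' \<in> word_class S R v" for u' v'
    using word_class_eq[OF word_eq_append[of u u' v v']] that by (simp add: word_class_def)
  moreover have "u \<in> word_class S R u" "v \<in> word_class S R v"
    using assms by (auto simp: word_class_def word_eq.refl)
  ultimately have "(\<Union>u'\<in>word_class S R u. \<Union>v'\<in>word_class S R v. word_class S R (u' @ v')) =
      word_class S R (u @ v)"
    by blast
  then show ?thesis by (simp add: presented_group_def)
qed

lemma word_inverse:
  "w \<in> words S \<Longrightarrow> \<exists>v\<in>words S. word_eq S R (v @ w) []"
proof (induction w)
  case Nil then show ?case by (intro bexI[of _ "[]"]) (auto simp: word_eq.refl)
next
  case (Cons l w)
  obtain s e where l: "l = (s, e)" by (cases l)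
  from Cons l obtain v where v: "v \<in> words S" "word_eq S R (v @ w) []" by auto
  have "word_eq S R (v @ [(s, flip e), (s, flip (flip e))] @ w) (v @ w)"
    by (rule word_eq.cancel) (use Cons v l in auto)
  then have "word_eq S R ((v @ [(s, flip e)]) @ l # w) []"
    using word_eq.trans[OF _ v(2)] l by simp
  with v l Cons.prems show ?case
    by (intro bexI[of _ "v @ [(s, flip e)]"]) simp_all
qed

lemma presented_group_group: "group (presented_group S R)"
proof (rule groupI)
  fix x assume "x \<in> carrier (presented_group S R)"
  then obtain w where w: "w \<in> words S" "x = word_class S R w"
    by (auto simp: presented_group_def)
  obtain v where v: "v \<in> words S" "word_eq S R (v @ w) []" using word_inverse[OF w(1)] by auto
  show "\<exists>y\<in>carrier (presented_group S R). y \<otimes>\<^bsub>presented_group S R\<^esub> x = \<one>\<^bsub>presented_group S R\<^esub>"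
    using v w word_class_mult[of v w] word_class_eq[OF v(2)]
    by (intro bexI[of _ "word_class S R v"]) (auto simp: presented_group_def)
next
  fix x assume "x \<in> carrier (presented_group S R)"
  then obtain w where w: "w \<in> words S" "x = word_class S R w"
    by (auto simp: presented_group_def)
  then show "\<one>\<^bsub>presented_group S R\<^esub> \<otimes>\<^bsub>presented_group S R\<^esub> x = x"
    using word_class_mult[of "[]" w] by (simp add: presented_group_def)
next
  fix x y z assume "x \<in> carrier (presented_group S R)" "y \<in> carrier (presented_group S R)"
     "z \<in> carrier (presented_group S R)"
  then obtain u v w where "u \<in> words S" "x = word_class S R u" "v \<in> words S" "y = word_class S R v"
    "w \<in> words S" "z = word_class S R w"
    by (auto simp: presented_group_def)
  then show "x \<otimes>\<^bsub>presented_group S R\<^esub> y \<otimes>\<^bsub>presented_group S R\<^esub> z =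
    x \<otimes>\<^bsub>presented_group S R\<^esub> (y \<otimes>\<^bsub>presented_group S R\<^esub> z)"
    by (simp add: word_class_mult)
next
  fix x y assume "x \<in> carrier (presented_group S R)" "y \<in> carrier (presented_group S R)"
  then obtain u v where "u \<in> words S" "x = word_class S R u" "v \<in> words S" "y = word_class S R v"
    by (auto simp: presented_group_def)
  then show "x \<otimes>\<^bsub>presented_group S R\<^esub> y \<in> carrier (presented_group S R)"
    using word_class_mult[of u v] by (auto simp: presented_group_def)
qed (auto simp: presented_group_def)

end

lemma letter_map_simps [simp]:
  "letter_map f [] = []" "letter_map f (u @ v) = letter_map f u @ letter_map f v"
  "letter_map f ((s, e) # w) = (fst (f s), sign_mult (snd (f s)) e) # letter_map f w"
  by (auto simp: letter_map_def)

lemma sign_mult_flip: "sign_mult d (flip e) = flip (sign_mult d e)"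
  by (cases d) auto

context
  fixes S :: "'g set" and R and T :: "'h set" and Q and f :: "'g \<Rightarrow> 'h \<times> sign"
  assumes R: "R \<subseteq> words S \<times> words S" and Q: "Q \<subseteq> words T \<times> words T"
    and f: "\<And>s. s \<in> S \<Longrightarrow> fst (f s) \<in> T"
    and fR: "\<And>p q. (p, q) \<in> R \<Longrightarrow> word_eq T Q (letter_map f p) (letter_map f q)"
begin

lemma letter_map_words: "w \<in> words S \<Longrightarrow> letter_map f w \<in> words T"
  using f by (induction w) auto

lemma letter_map_word_eq:
  "word_eq S R u v \<Longrightarrow> word_eq T Q (letter_map f u) (letter_map f v)"
proof (induction rule: word_eq.induct)
  case (refl w) then show ?case by (simp add: word_eq.refl letter_map_words)
next
  case (sym v w) then show ?case by (blast intro: word_eq.sym)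
next
  case (trans u v w) then show ?case by (meson word_eq.trans)
next
  case (cancel u v s e)
  then show ?case
    using word_eq.cancel[of "letter_map f u" T "letter_map f v" "fst (f s)" Q "sign_mult (snd (f s)) e"]
    by (simp add: letter_map_words f sign_mult_flip)
next
  case (rel u v p q)
  then show ?case
    using word_eq_ctxt[OF Q fR[OF rel(3)], of "letter_map f u" "letter_map f v"]
    by (simp add: letter_map_words)
qed

lemma pres_hom_class:
  assumes "w \<in> words S"
  shows "pres_hom T Q f (word_class S R w) = word_class T Q (letter_map f w)"
proof -
  have "word_class T Q (letter_map f v) = word_class T Q (letter_map f w)"
    if "v \<in> word_class S R w" for v
    using word_class_eq[OF Q letter_map_word_eq[of w v]] that by (simp add: word_class_def)
  moreover have "w \<in> word_class S R w" using assms by (simp add: word_class_def word_eq.refl)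
  ultimately show ?thesis unfolding pres_hom_def by blast
qed

lemma pres_hom_hom: "pres_hom T Q f \<in> hom (presented_group S R) (presented_group T Q)"
proof (rule homI)
  fix x assume "x \<in> carrier (presented_group S R)"
  then show "pres_hom T Q f x \<in> carrier (presented_group T Q)"
    by (auto simp: presented_group_def pres_hom_class letter_map_words)
next
  fix x y assume "x \<in> carrier (presented_group S R)" "y \<in> carrier (presented_group S R)"
  then obtain u v where "u \<in> words S" "x = word_class S R u" "v \<in> words S" "y = word_class S R v"
    by (auto simp: presented_group_def)
  then show "pres_hom T Q f (x \<otimes>\<^bsub>presented_group S R\<^esub> y) =
      pres_hom T Q f x \<otimes>\<^bsub>presented_group T Q\<^esub> pres_hom T Q f y"
    by (simp add: pres_hom_class word_class_mult[OF R] word_class_mult[OF Q] letter_map_words)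
qed

end

lemma (in quandle) quandle_rels_words: "quandle_rels X qop \<subseteq> words X \<times> words X"
  using closed by (auto simp: quandle_rels_def)

lemma (in symmetric_quandle) symm_rels_words: "symm_rels X qop \<rho> \<subseteq> words X \<times> words X"
  using quandle_rels_words rho_closed by (auto simp: symm_rels_def)

lemma (in quandle) word_eq_signed_op:
  assumes "x \<in> X" "y \<in> X"
  shows "word_eq X (quandle_rels X qop) [(signed_op X qop x y d, e)] [(y, flip d), (x, e), (y, d)]"
proof -
  let ?R = "quandle_rels X qop"
  note ctxt = word_eq_ctxt[OF quandle_rels_words]
  have pos: "word_eq X ?R [(qop a b, Pos)] [(b, Neg), (a, Pos), (b, Pos)]"
    if "a \<in> X" "b \<in> X" for a b
    using word_eq.rel[of "[]" X "[]" "[(qop a b, Pos)]" "[(b, Neg), (a, Pos), (b, Pos)]" ?R] that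
    by (auto simp: quandle_rels_def)
  have sgn: "word_eq X ?R [(signed_op X qop x y d, Pos)] [(y, flip d), (x, Pos), (y, d)]"
  proof (cases d)
    case Neg
    let ?z = "qop_inv X qop x y"
    have z: "?z \<in> X" "qop ?z y = x" using assms qop_inv_closed qop_qop_inv by auto
    have 1: "word_eq X ?R [(y, Pos), (x, Pos), (y, Neg)]
        [(y, Pos), (y, Neg), (?z, Pos), (y, Pos), (y, Neg)]"
      using ctxt[OF pos[OF z(1) assms(2)], of "[(y, Pos)]" "[(y, Neg)]"] z assms by simp
    have 2: "word_eq X ?R [(y, Pos), (y, Neg), (?z, Pos), (y, Pos), (y, Neg)]
        [(?z, Pos), (y, Pos), (y, Neg)]"
      using word_eq.cancel[of "[]" X "[(?z, Pos), (y, Pos), (y, Neg)]" y ?R Pos] z assms by simp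
    have 3: "word_eq X ?R [(?z, Pos), (y, Pos), (y, Neg)] [(?z, Pos)]"
      using word_eq.cancel[of "[(?z, Pos)]" X "[]" y ?R Pos] z assms by simp
    show ?thesis using Neg word_eq.sym[OF word_eq.trans[OF 1 word_eq.trans[OF 2 3]]] by simp
  qed (use pos assms in auto)
  show ?thesis
  proof (cases e)
    case Neg
    let ?s = "signed_op X qop x y d" and ?v = "[(y, flip d), (x, Neg), (y, d)]"
    have s: "?s \<in> X" using assms signed_op_closed by blast
    have "word_eq X ?R ([(?s, Neg)] @ [(?s, Pos)] @ ?v) ([(?s, Neg)] @ [(y, flip d), (x, Pos), (y, d)] @ ?v)"
      by (rule ctxt[OF sgn]) (use s assms in auto)
    moreover have "word_eq X ?R ([(?s, Neg)] @ [(?s, Pos)] @ ?v) ?v"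
      using word_eq.cancel[of "[]" X ?v ?s ?R Neg] s assms by simp
    moreover have "word_eq X ?R ([(?s, Neg)] @ [(y, flip d), (x, Pos), (y, d)] @ ?v)
       [(?s, Neg), (y, flip d), (x, Pos), (x, Neg), (y, d)]"
      using word_eq.cancel[of "[(?s, Neg), (y, flip d), (x, Pos)]" X "[(x, Neg), (y, d)]" y ?R d] s assms
      by simp
    moreover have "word_eq X ?R [(?s, Neg), (y, flip d), (x, Pos), (x, Neg), (y, d)]
       [(?s, Neg), (y, flip d), (y, d)]"
      using word_eq.cancel[of "[(?s, Neg), (y, flip d)]" X "[(y, d)]" x ?R Pos] s assms by simp
    moreover have "word_eq X ?R [(?s, Neg), (y, flip d), (y, d)] [(?s, Neg)]"
      using word_eq.cancel[of "[(?s, Neg)]" X "[]" y ?R "flip d"] s assms by simp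
    ultimately have "word_eq X ?R ?v [(?s, Neg)]"
      by - (rule word_eq.trans[OF word_eq.sym], assumption, rule word_eq.trans, assumption,
          rule word_eq.trans, assumption, rule word_eq.trans, assumption+)
    then show ?thesis unfolding Neg by (rule word_eq.sym)
  qed (use sgn in auto)
qed

context quandle
begin

interpretation D: symmetric_quandle "double X" "double_op X qop" double_inv
  by (rule double_symmetric_quandle)

lemma double_proj_rels:
  assumes "(p, q) \<in> symm_rels (double X) (double_op X qop) double_inv"
  shows "word_eq X (quandle_rels X qop) (letter_map id p) (letter_map id q)"
proof -
  have m: "sign_mult e Pos = e" "sign_mult e Neg = flip e" for e by (cases e; simp)+
  consider (q) x e y d where "x \<in> X" "y \<in> X" "p = [(double_op X qop (x, e) (y, d), Pos)]"
      "q = [((y, d), Neg), ((x, e), Pos), ((y, d), Pos)]"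
    | (inv) x e where "x \<in> X" "p = [((x, flip e), Pos)]" "q = [((x, e), Neg)]"
    using assms unfolding symm_rels_def quandle_rels_def double_def by force
  then show ?thesis
  proof cases
    case q
    then show ?thesis using word_eq_signed_op[of x y d e] by (simp add: m)
  next
    case inv
    then show ?thesis by (simp add: m word_eq.refl)
  qed
qed

lemma double_proj_hom:
  "double_proj X qop \<in>
     hom (symm_assoc_group (double X) (double_op X qop) double_inv) (assoc_group X qop)"
  unfolding double_proj_def symm_assoc_group_def assoc_group_def
  by (rule pres_hom_hom[OF D.symm_rels_words quandle_rels_words])
    (auto simp: double_def intro: double_proj_rels)

lemma double_proj_gen:
  assumes "x \<in> X"
  shows "double_proj X qop
      (pres_gen (double X) (symm_rels (double X) (double_op X qop) double_inv) (x, e)) =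
    word_class X (quandle_rels X qop) [(x, e)]"
proof -
  have "double_proj X qop
      (word_class (double X) (symm_rels (double X) (double_op X qop) double_inv) [((x, e), Pos)]) =
    word_class X (quandle_rels X qop) (letter_map id [((x, e), Pos)])"
    unfolding double_proj_def
    by (rule pres_hom_class[OF D.symm_rels_words quandle_rels_words])
      (use assms in \<open>auto simp: double_def intro: double_proj_rels\<close>)
  then show ?thesis by (cases e) (auto simp: pres_gen_def)
qed

lemma double_act_symm_quandle_set:
  assumes "quandle_set X qop Y act"
  shows "symm_quandle_set (double X) (double_op X qop) double_inv Y (double_act X qop act)"
proof -
  interpret right_action "assoc_group X qop" Y act by (rule assms)
  let ?G = "symm_assoc_group (double X) (double_op X qop) double_inv"
  have G: "group ?G"
    unfolding symm_assoc_group_def by (rule presented_group_group[OF D.symm_rels_words])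
  interpret group_hom ?G "assoc_group X qop" "double_proj X qop"
    using G group double_proj_hom by (simp add: group_hom_def group_hom_axioms_def)
  show ?thesis
    by unfold_locales (auto simp: double_act_def G act_closed act_one act_mult)
qed

end

end

theory Submission
  imports Defs
begin

text \<open>
  The two chain complexes are isomorphic, so all their homology and cohomology groups are.

  In the symmetric complex of the double, the relation
  \[ (r, x_1, \ldots, x_n) = - (r * x_i, x_1 * x_i, \ldots, x_{i-1} * x_i, \rho(x_i), x_{i+1}, \ldots, x_n) \]
  replaces a negative letter by a positive one at the price of a sign and of letting the negative
  letter act on everything to its left. Applied to every negative letter it turns a generator over
  the double into plus or minus a generator over \<open>X\<close>. The result does not depend on the order of the
  replacements, because acting by \<open>x\<close> and then by \<open>y\<close> is acting by \<open>y\<close> and then by \<open>x * y\<close>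
  (\<open>push_distrib\<close>). This defines a map \<open>to_positive\<close> from chains over the double to chains over \<open>X\<close>.
  In the other direction, \<open>embed_gen\<close> regards the elements of \<open>X\<close> as positive letters. Everything
  rests on the following facts.

  \<^item> Both maps commute with the boundary already before passing to quotients (\<open>embed_bdry\<close>,
    \<open>to_positive_bdry\<close>). For a negative letter \<open>x\<close>, the two summands of the face that removes \<open>x\<close> change
    places under \<open>to_positive\<close>, since \<open>x\<close> acts after its inverse; the sign makes up for this.
  \<^item> \<open>to_positive\<close> inverts the embedding (\<open>to_positive_embed\<close>), and the other composite is the
    identity modulo the relations (\<open>embed_to_positive_mod_SQ\<close>).
  \<^item> The embedding sends degenerate chains to degenerate chains (\<open>embed_degen\<close>). Conversely
    \<open>to_positive\<close> sends degenerate chains to degenerate chains and kills the relations above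
    (\<open>to_positive_SQ\<close>).

  Together they also show that the boundary of the double preserves the subgroup that is divided out
  (\<open>bdD_SQ\<close>): this subgroup consists of the chains that \<open>to_positive\<close> makes degenerate, so the
  question is pulled back to degenerate chains over \<open>X\<close>.

  Inductions over a generator remove its last letter: the boundary of \<open>snoc x b\<close> is obtained by
  appending \<open>x\<close> to the boundary of \<open>b\<close> and adding, up to sign, the difference of \<open>b\<close> and its translate
  by \<open>x\<close> (\<open>faces_snoc\<close>).
\<close>

section \<open>Transport of (co)homology along isomorphisms\<close>

lemma iso_preserves_one:
  assumes "monoid G" "monoid H" "f \<in> iso G H"
  shows "f \<one>\<^bsub>G\<^esub> = \<one>\<^bsub>H\<^esub>"
proof -
  interpret G: monoid G by (rule assms)
  interpret H: monoid H by (rule assms)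
  have hom: "f \<in> hom G H" and im: "f ` carrier G = carrier H"
    using assms(3) by (simp_all add: iso_def bij_betw_def)
  from im obtain x where x: "x \<in> carrier G" "f x = \<one>\<^bsub>H\<^esub>"
    by (metis H.one_closed imageE)
  have "f \<one>\<^bsub>G\<^esub> \<in> carrier H"
    using hom by (simp add: hom_in_carrier)
  then have "f \<one>\<^bsub>G\<^esub> = f \<one>\<^bsub>G\<^esub> \<otimes>\<^bsub>H\<^esub> f x" unfolding x by (rule H.r_one[symmetric])
  also have "\<dots> = f (\<one>\<^bsub>G\<^esub> \<otimes>\<^bsub>G\<^esub> x)" by (rule hom_mult[OF hom G.one_closed x(1), symmetric])
  also have "\<dots> = \<one>\<^bsub>H\<^esub>" unfolding G.l_one[OF x(1)] by (rule x)
  finally show ?thesis .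
qed

lemma coset_carrier_update [simp]:
  "A #>\<^bsub>G\<lparr>carrier := B\<rparr>\<^esub> x = A #>\<^bsub>G\<^esub> x" "A <#>\<^bsub>G\<lparr>carrier := B\<rparr>\<^esub> C = A <#>\<^bsub>G\<^esub> C"
  unfolding r_coset_def set_mult_def by simp_all

text \<open>
  Cosets and their products are built from the multiplication alone, so an isomorphism carries the
  cosets of \<open>N\<close> to those of its image. Homology is of this form with \<open>K\<close> the
  cycles and \<open>N\<close> the boundaries.
\<close>

lemma iso_Mod_image:
  assumes "monoid G" "f \<in> iso G H" "K \<subseteq> carrier G" "N \<subseteq> carrier G"
  shows "(`) f \<in> iso (G\<lparr>carrier := K\<rparr> Mod N) (H\<lparr>carrier := f ` K\<rparr> Mod f ` N)"
proof -
  interpret G: monoid G by (rule assms)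
  have inj: "inj_on f (carrier G)" and f: "f \<in> hom G H"
    using assms(2) by (auto simp: iso_def bij_betw_def)
  have mult: "f ` (P <#>\<^bsub>G\<^esub> Q) = f ` P <#>\<^bsub>H\<^esub> f ` Q"
    if "P \<subseteq> carrier G" "Q \<subseteq> carrier G" for P Q
  proof -
    have "f (x \<otimes>\<^bsub>G\<^esub> y) = f x \<otimes>\<^bsub>H\<^esub> f y" if "x \<in> P" "y \<in> Q" for x y
      using hom_mult[OF f] that \<open>P \<subseteq> _\<close> \<open>Q \<subseteq> _\<close> by blast
    then show ?thesis by (simp add: set_mult_def image_UN)
  qed
  have coset: "f ` (N #>\<^bsub>G\<^esub> x) = f ` N #>\<^bsub>H\<^esub> f x" if "x \<in> carrier G" for x
    using mult[of N "{x}"] that assms(4) by (simp add: r_coset_eq_set_mult)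
  have car: "carrier (G\<lparr>carrier := K\<rparr> Mod N) = (\<lambda>x. N #>\<^bsub>G\<^esub> x) ` K"
    "carrier (H\<lparr>carrier := f ` K\<rparr> Mod f ` N) = (\<lambda>x. f ` N #>\<^bsub>H\<^esub> x) ` f ` K"
    by (auto simp: carrier_FactGroup)
  have sub: "P \<subseteq> carrier G" if "P \<in> carrier (G\<lparr>carrier := K\<rparr> Mod N)" for P
    using that assms(3) G.r_coset_subset_G[OF assms(4)] unfolding car by blast
  have "bij_betw ((`) f) (carrier (G\<lparr>carrier := K\<rparr> Mod N))
      (carrier (H\<lparr>carrier := f ` K\<rparr> Mod f ` N))"
  proof (rule bij_betw_imageI)
    show "inj_on ((`) f) (carrier (G\<lparr>carrier := K\<rparr> Mod N))"
      by (rule inj_onI) (simp add: inj_on_image_eq_iff[OF inj] sub)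
    show "(`) f ` carrier (G\<lparr>carrier := K\<rparr> Mod N) = carrier (H\<lparr>carrier := f ` K\<rparr> Mod f ` N)"
      unfolding car image_image by (rule image_cong) (use assms(3) coset in auto)
  qed
  moreover from bij_betwE[OF this] have "(`) f \<in> hom (G\<lparr>carrier := K\<rparr> Mod N) (H\<lparr>carrier := f ` K\<rparr> Mod f ` N)"
    by (intro homI) (simp_all add: mult[OF sub sub])
  ultimately show ?thesis by (simp add: iso_def)
qed

proposition homology_iso:
  assumes "\<And>k. monoid (C k)" "\<And>k. monoid (C' k)"
    and f: "\<And>k. f k \<in> iso (C k) (C' k)"
    and d: "\<And>k x. x \<in> carrier (C k) \<Longrightarrow> d k x \<in> carrier (C (k - 1))"
    and comm: "\<And>k x. x \<in> carrier (C k) \<Longrightarrow> f (k - 1) (d k x) = d' k (f k x)"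
  shows "homology C d n \<cong> homology C' d' n"
proof -
  have bij: "bij_betw (f k) (carrier (C k)) (carrier (C' k))" for k
    using f by (simp add: iso_def)
  have im: "f k ` carrier (C k) = carrier (C' k)" for k
    using bij by (simp add: bij_betw_def)
  have one: "f k \<one>\<^bsub>C k\<^esub> = \<one>\<^bsub>C' k\<^esub>" for k
    using assms(1,2) f by (rule iso_preserves_one)
  have ker_iff: "d' n (f n x) = \<one>\<^bsub>C' (n - 1)\<^esub> \<longleftrightarrow> d n x = \<one>\<^bsub>C (n - 1)\<^esub>" if "x \<in> carrier (C n)" for x
    using that bij_betw_imp_inj_on[OF bij[of "n - 1"]] d[OF that] monoid.one_closed[OF assms(1)]
    by (metis comm inj_onD one)
  have ker: "kernel (C' n) (C' (n - 1)) (d' n) = f n ` kernel (C n) (C (n - 1)) (d n)"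
    using ker_iff unfolding kernel_def im[symmetric] by auto
  have bd: "d' (n + 1) ` carrier (C' (n + 1)) = f n ` d (n + 1) ` carrier (C (n + 1))"
    using comm[of _ "n + 1"] unfolding im[symmetric] image_image by (auto intro!: image_cong)
  have "kernel (C n) (C (n - 1)) (d n) \<subseteq> carrier (C n)" "d (n + 1) ` carrier (C (n + 1)) \<subseteq> carrier (C n)"
    using d[of _ "n + 1"] by (auto simp: kernel_def)
  then show ?thesis
    using iso_Mod_image[OF assms(1) f] unfolding homology_def ker bd by (blast intro: is_isoI)
qed

text \<open>
  A cochain complex is a chain complex with negated degrees, so \<open>homology_iso\<close> serves both parts of
  the theorem.
\<close>

lemma cohomology_eq_homology:
  "cohomology C d n = homology (\<lambda>k. C (- k)) (\<lambda>k. d (- k)) (- n)"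
  by (simp add: cohomology_def homology_def algebra_simps)

subsection \<open>Maps between quotients\<close>

lemma coset_absorb:
  assumes "group G" "subgroup N G" "u \<in> N" "x \<in> carrier G"
  shows "N #>\<^bsub>G\<^esub> (u \<otimes>\<^bsub>G\<^esub> x) = N #>\<^bsub>G\<^esub> x"
proof -
  interpret G: group G by (rule assms)
  interpret N: subgroup N G by (rule assms)
  have "N #>\<^bsub>G\<^esub> (u \<otimes>\<^bsub>G\<^esub> x) = N #>\<^bsub>G\<^esub> u #>\<^bsub>G\<^esub> x"
    using assms by (intro G.coset_mult_assoc[symmetric]) (auto intro: N.subset)
  also have "N #>\<^bsub>G\<^esub> u = N"
    using assms by (intro G.coset_join2) auto
  finally show ?thesis .
qed

lemma quot_map_coset:
  assumes "comm_group G" "comm_group H" "subgroup N G" "subgroup M H"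
    and f: "f \<in> hom G H" "f ` N \<subseteq> M" and x: "x \<in> carrier G"
  shows "quot_map H M f (N #>\<^bsub>G\<^esub> x) = M #>\<^bsub>H\<^esub> f x"
proof -
  interpret G: comm_group G by (rule assms)
  interpret H: comm_group H by (rule assms)
  interpret N: subgroup N G by (rule assms)
  interpret M: subgroup M H by (rule assms)
  have fx: "f x \<in> carrier H" using f(1) x by (rule hom_in_carrier)
  have "M #>\<^bsub>H\<^esub> f (u \<otimes>\<^bsub>G\<^esub> x) = M #>\<^bsub>H\<^esub> f x" if "u \<in> N" for u
    using hom_mult[OF f(1) N.mem_carrier[OF that] x] coset_absorb[OF H.is_group assms(4) _ fx, of "f u"]
      f(2) that by auto
  moreover have "N \<noteq> {}" using N.one_closed by blast
  ultimately show ?thesis unfolding quot_map_def r_coset_def[of G] by simp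
qed

lemma quot_map_hom:
  assumes "comm_group G" "comm_group H" "subgroup N G" "subgroup M H"
    and f: "f \<in> hom G H" "f ` N \<subseteq> M"
  shows "quot_map H M f \<in> hom (G Mod N) (H Mod M)"
proof -
  interpret G: comm_group G by (rule assms)
  interpret H: comm_group H by (rule assms)
  interpret N: normal N G using assms(3) by (simp add: G.normal_iff_subgroup)
  interpret M: normal M H using assms(4) by (simp add: H.normal_iff_subgroup)
  note coset = quot_map_coset[OF assms(1-4) f]
  have fc: "f x \<in> carrier H" if "x \<in> carrier G" for x using f(1) that by (rule hom_in_carrier)
  show ?thesis
  proof (rule homI)
    fix P assume "P \<in> carrier (G Mod N)"
    then show "quot_map H M f P \<in> carrier (H Mod M)"
      by (auto simp: carrier_FactGroup coset fc)
  next
    fix P Q assume "P \<in> carrier (G Mod N)" "Q \<in> carrier (G Mod N)"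
    then obtain x y where "x \<in> carrier G" "P = N #>\<^bsub>G\<^esub> x" "y \<in> carrier G" "Q = N #>\<^bsub>G\<^esub> y"
      by (auto simp: carrier_FactGroup)
    then show "quot_map H M f (P \<otimes>\<^bsub>G Mod N\<^esub> Q) = quot_map H M f P \<otimes>\<^bsub>H Mod M\<^esub> quot_map H M f Q"
      by (simp add: N.rcos_sum M.rcos_sum coset fc hom_mult[OF f(1)])
  qed
qed

text \<open>
  Homomorphisms that are inverse to each other only up to the subgroups divided out induce mutually
  inverse isomorphisms of the quotients. For the double, \<open>g \<circ> f\<close> is the identity on the nose, while
  \<open>f \<circ> g\<close> is so only modulo \<open>M\<close>.
\<close>

lemma quot_map_isomorphisms:
  assumes G: "comm_group G" and H: "comm_group H" and N: "subgroup N G" and M: "subgroup M H"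
    and f: "f \<in> hom G H" "f ` N \<subseteq> M" and g: "g \<in> hom H G" "g ` M \<subseteq> N"
    and gf: "\<And>x. x \<in> carrier G \<Longrightarrow> N #>\<^bsub>G\<^esub> g (f x) = N #>\<^bsub>G\<^esub> x"
    and f_g: "\<And>y. y \<in> carrier H \<Longrightarrow> M #>\<^bsub>H\<^esub> f (g y) = M #>\<^bsub>H\<^esub> y"
  shows "group_isomorphisms (G Mod N) (H Mod M) (quot_map H M f) (quot_map G N g)"
  unfolding group_isomorphisms_def carrier_FactGroup
  using quot_map_hom[OF G H N M f] quot_map_hom[OF H G M N g]
  by (simp add: quot_map_coset[OF G H N M f] quot_map_coset[OF H G M N g] gf f_g
      hom_in_carrier[OF f(1)] hom_in_carrier[OF g(1)])

subsection \<open>Tensor products\<close>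

lemma frag_extend_hom:
  assumes "\<And>x. x \<in> S \<Longrightarrow> Poly_Mapping.keys (h x) \<subseteq> T"
  shows "frag_extend h \<in> hom (free_Abelian_group S) (free_Abelian_group T)"
proof (rule homI)
  fix c assume "c \<in> carrier (free_Abelian_group S)"
  then show "frag_extend h c \<in> carrier (free_Abelian_group T)"
    using assms by (auto dest!: subsetD[OF keys_frag_extend])
qed (simp add: frag_extend_add)

lemma frag_extend_inverse:
  assumes "Poly_Mapping.keys c \<subseteq> S" "\<And>x. x \<in> S \<Longrightarrow> p (q x) = x"
  shows "frag_extend (frag_of \<circ> p) (frag_extend (frag_of \<circ> q) c) = c"
proof -
  have "frag_extend (frag_of \<circ> p \<circ> q) c = frag_extend frag_of c"
    using assms by (intro frag_extend_eq) auto
  then show ?thesis by (simp add: frag_extend_compose flip: frag_expansion)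
qed

lemma frag_extend_iso:
  assumes "bij_betw h S T"
  shows "frag_extend (frag_of \<circ> h) \<in> iso (free_Abelian_group S) (free_Abelian_group T)"
proof -
  have hom: "frag_extend (frag_of \<circ> h) \<in> hom (free_Abelian_group S) (free_Abelian_group T)"
    using assms by (intro frag_extend_hom) (auto dest: bij_betwE)
  have inv: "frag_extend (frag_of \<circ> inv_into S h) \<in> hom (free_Abelian_group T) (free_Abelian_group S)"
    using bij_betwE[OF bij_betw_inv_into[OF assms]] by (intro frag_extend_hom) auto
  have "group_isomorphisms (free_Abelian_group S) (free_Abelian_group T)
      (frag_extend (frag_of \<circ> h)) (frag_extend (frag_of \<circ> inv_into S h))"
    unfolding group_isomorphisms_def
    using hom inv frag_extend_inverse[of _ S "inv_into S h" h, OF _ bij_betw_inv_into_left[OF assms]]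
      frag_extend_inverse[of _ T h "inv_into S h", OF _ bij_betw_inv_into_right[OF assms]]
    by simp
  then show ?thesis by (rule group_isomorphisms_imp_iso)
qed

abbreviation free_tensor_map :: "('a \<Rightarrow> 'b) \<Rightarrow> ('a \<times> 'c \<Rightarrow>\<^sub>0 int) \<Rightarrow> ('b \<times> 'c \<Rightarrow>\<^sub>0 int)" where
  "free_tensor_map f \<equiv> frag_extend (\<lambda>(g, a). frag_of (f g, a))"

lemma tensor_rels_left:
  "\<lbrakk>g \<in> carrier G; h \<in> carrier G; a \<in> carrier A\<rbrakk>
    \<Longrightarrow> frag_of (g \<otimes>\<^bsub>G\<^esub> h, a) - (frag_of (g, a) + frag_of (h, a)) \<in> tensor_rels G A"
  unfolding tensor_rels_def by blast

lemma tensor_rels_right: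
  "\<lbrakk>g \<in> carrier G; a \<in> carrier A; b \<in> carrier A\<rbrakk>
    \<Longrightarrow> frag_of (g, a \<otimes>\<^bsub>A\<^esub> b) - (frag_of (g, a) + frag_of (g, b)) \<in> tensor_rels G A"
  unfolding tensor_rels_def by blast

lemma tensor_rels_subset:
  assumes "monoid G" "monoid A"
  shows "tensor_rels G A \<subseteq> carrier (free_Abelian_group (carrier G \<times> carrier A))"
proof -
  interpret G: monoid G by (rule assms)
  interpret A: monoid A by (rule assms)
  have k: "Poly_Mapping.keys (frag_of x - (frag_of y + frag_of z)) \<subseteq> {x, y, z}" for x y z :: "'a \<times> 'c"
    using keys_diff[of "frag_of x" "frag_of y + frag_of z"] keys_add[of "frag_of y" "frag_of z"] by auto
  show ?thesis
    by (auto simp: tensor_rels_def dest!: subsetD[OF k])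
qed

lemma tensor_kernel_subgroup:
  assumes "monoid G" "monoid A"
  shows "subgroup (tensor_kernel G A) (free_Abelian_group (carrier G \<times> carrier A))"
  unfolding tensor_kernel_def
  by (rule group.generate_is_subgroup[OF group_free_Abelian_group tensor_rels_subset[OF assms]])

lemma tensor_monoid:
  assumes "monoid G" "monoid A"
  shows "monoid (tensor G A)"
  unfolding tensor_def
  using comm_group.abelian_FactGroup[OF abelian_free_Abelian_group tensor_kernel_subgroup[OF assms]]
  by (simp add: comm_group_def group_def)

lemma free_tensor_map_iso:
  assumes "f \<in> iso G H"
  shows "free_tensor_map f
    \<in> iso (free_Abelian_group (carrier G \<times> carrier A)) (free_Abelian_group (carrier H \<times> carrier A))"
proof -
  have "bij_betw (map_prod f id) (carrier G \<times> carrier A) (carrier H \<times> carrier A)"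
    using assms by (intro bij_betw_map_prod) (auto simp: iso_def)
  from frag_extend_iso[OF this] show ?thesis by (simp add: comp_def case_prod_unfold map_prod_def)
qed

lemma free_tensor_map_rels:
  assumes "f \<in> hom G H"
  shows "free_tensor_map f ` tensor_rels G A \<subseteq> tensor_rels H A"
proof (rule image_subsetI)
  fix t assume "t \<in> tensor_rels G A"
  then consider g h a where "g \<in> carrier G" "h \<in> carrier G" "a \<in> carrier A"
      "t = frag_of (g \<otimes>\<^bsub>G\<^esub> h, a) - (frag_of (g, a) + frag_of (h, a))"
    | g a b where "g \<in> carrier G" "a \<in> carrier A" "b \<in> carrier A"
      "t = frag_of (g, a \<otimes>\<^bsub>A\<^esub> b) - (frag_of (g, a) + frag_of (g, b))"
    unfolding tensor_rels_def by blast
  then show "free_tensor_map f t \<in> tensor_rels H A"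
  proof cases
    case (1 g h a)
    then show ?thesis
      using tensor_rels_left[of "f g" H "f h" a A] hom_in_carrier[OF assms]
      by (simp add: frag_extend_diff frag_extend_add hom_mult[OF assms])
  next
    case (2 g a b)
    then show ?thesis
      using tensor_rels_right[of "f g" H a A b] hom_in_carrier[OF assms]
      by (simp add: frag_extend_diff frag_extend_add)
  qed
qed

lemma free_tensor_map_hom:
  assumes "f \<in> hom G H"
  shows "free_tensor_map f
    \<in> hom (free_Abelian_group (carrier G \<times> carrier A)) (free_Abelian_group (carrier H \<times> carrier A))"
  using hom_in_carrier[OF assms] by (intro frag_extend_hom) auto

lemma free_tensor_map_kernel_subset:
  assumes "monoid G" "monoid A" "f \<in> hom G H"
  shows "free_tensor_map f ` tensor_kernel G A \<subseteq> tensor_kernel H A"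
proof -
  have "group_hom (free_Abelian_group (carrier G \<times> carrier A))
      (free_Abelian_group (carrier H \<times> carrier A)) (free_tensor_map f)"
    using free_tensor_map_hom[OF assms(3)] by (simp add: group_hom_def group_hom_axioms_def)
  from group_hom.generate_img[OF this tensor_rels_subset[OF assms(1,2)]]
    group.mono_generate[OF group_free_Abelian_group free_tensor_map_rels[OF assms(3)]]
  show ?thesis unfolding tensor_kernel_def by blast
qed

text \<open>
  For an isomorphism \<open>f\<close> the defining relations of the two tensor products correspond exactly, so the
  isomorphism of free groups maps one kernel onto the other. The tensor product is then transported by
  taking images of cosets, as in \<open>iso_Mod_image\<close>.
\<close>

lemma free_tensor_map_kernel:
  assumes "monoid G" "monoid A" and f: "f \<in> iso G H"
  shows "free_tensor_map f ` tensor_kernel G A = tensor_kernel H A"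
proof -
  let ?F = "free_tensor_map f :: ('a \<times> 'c \<Rightarrow>\<^sub>0 int) \<Rightarrow> _"
  let ?r1 = "\<lambda>L g h a. frag_of (g \<otimes>\<^bsub>L\<^esub> h, a) - (frag_of (g, a) + frag_of (h, a))"
  let ?r2 = "\<lambda>g a b. frag_of (g, a \<otimes>\<^bsub>A\<^esub> b) - (frag_of (g, a) + frag_of (g, b))"
  have im: "carrier H = f ` carrier G"
    using f by (simp add: iso_def bij_betw_def)
  have r1: "?r1 H (f g) (f h) a = ?F (?r1 G g h a)" if "g \<in> carrier G" "h \<in> carrier G" for g h a
    using f that by (simp add: frag_extend_diff frag_extend_add iso_def hom_mult[of f G H])
  have hom: "f \<in> hom G H" using f by (simp add: iso_def)
  have r2: "?r2 (f g) a b = ?F (?r2 g a b)" for g a b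
    by (simp add: frag_extend_diff frag_extend_add)
  have rels: "tensor_rels H A = ?F ` tensor_rels G A"
  proof (intro equalityI subsetI)
    fix t assume "t \<in> tensor_rels H A"
    then consider g h a where "g \<in> carrier G" "h \<in> carrier G" "a \<in> carrier A" "t = ?r1 H (f g) (f h) a"
      | g a b where "g \<in> carrier G" "a \<in> carrier A" "b \<in> carrier A" "t = ?r2 (f g) a b"
      unfolding tensor_rels_def im by blast
    then show "t \<in> ?F ` tensor_rels G A"
    proof cases
      case (1 g h a)
      show ?thesis
        unfolding \<open>t = _\<close> r1[OF 1(1,2)] by (rule imageI[OF tensor_rels_left[OF 1(1-3)]])
    next
      case (2 g a b)
      show ?thesis
        unfolding \<open>t = _\<close> r2 by (rule imageI[OF tensor_rels_right[OF 2(1-3)]])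
    qed
  qed (use free_tensor_map_rels[OF hom] in blast)
  have "group_hom (free_Abelian_group (carrier G \<times> carrier A))
      (free_Abelian_group (carrier H \<times> carrier A)) ?F"
    using free_tensor_map_iso[OF f, of A] by (simp add: group_hom_def group_hom_axioms_def iso_def)
  from group_hom.generate_img[OF this tensor_rels_subset[OF assms(1,2)]] show ?thesis
    unfolding tensor_kernel_def rels by simp
qed

lemma tensor_iso:
  assumes "monoid G" "monoid A" and f: "f \<in> iso G H"
  shows "(`) (free_tensor_map f) \<in> iso (tensor G A) (tensor H A)"
proof -
  let ?F = "free_Abelian_group (carrier G \<times> carrier A)"
  have "(`) (free_tensor_map f) \<in> iso (?F\<lparr>carrier := carrier ?F\<rparr> Mod tensor_kernel G A)
      (free_Abelian_group (carrier H \<times> carrier A)\<lparr>carrier := free_tensor_map f ` carrier ?F\<rparr>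
        Mod free_tensor_map f ` tensor_kernel G A)"
    using subgroup.subset[OF tensor_kernel_subgroup[OF assms(1,2)]]
      group.is_monoid[OF group_free_Abelian_group]
    by (intro iso_Mod_image free_tensor_map_iso f) auto
  moreover have "free_tensor_map f ` carrier ?F = carrier (free_Abelian_group (carrier H \<times> carrier A))"
    using free_tensor_map_iso[OF f, of A] by (simp add: iso_def bij_betw_def)
  ultimately show ?thesis
    unfolding tensor_def free_tensor_map_kernel[OF assms] by simp
qed

lemma tensor_carrier_subset:
  assumes "monoid G" "monoid A" "K \<in> carrier (tensor G A)"
  shows "K \<subseteq> carrier (free_Abelian_group (carrier G \<times> carrier A))"
proof -
  note coset = monoid.r_coset_subset_G[OF group.is_monoid[OF group_free_Abelian_group]
      subgroup.subset[OF tensor_kernel_subgroup[OF assms(1,2)]]]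
  obtain x where "x \<in> carrier (free_Abelian_group (carrier G \<times> carrier A))"
    "K = tensor_kernel G A #>\<^bsub>free_Abelian_group (carrier G \<times> carrier A)\<^esub> x"
    using assms(3) unfolding tensor_def carrier_FactGroup by blast
  then show ?thesis using coset by simp
qed

text \<open>
  On the level of free groups, \<open>f \<otimes> id\<close> and \<open>d \<otimes> id\<close> commute as soon as \<open>f\<close> and \<open>d\<close> do; the tensor
  differential of a class is a union of cosets over its representatives, and taking images under
  \<open>f \<otimes> id\<close> respects that union.
\<close>

lemma tensor_map_natural:
  fixes C1 :: "('a, 'm) monoid_scheme" and C1' :: "('b, 'n) monoid_scheme"
    and C0 :: "('c, 'p) monoid_scheme" and C0' :: "('d, 'q) monoid_scheme"
    and A :: "('e, 'r) monoid_scheme"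
  assumes mon: "monoid C1" "monoid C0" "monoid A"
    and f1: "f1 \<in> iso C1 C1'" and f0: "f0 \<in> iso C0 C0'"
    and d: "\<And>x. x \<in> carrier C1 \<Longrightarrow> d x \<in> carrier C0"
    and comm: "\<And>x. x \<in> carrier C1 \<Longrightarrow> f0 (d x) = d' (f1 x)"
    and K: "K \<in> carrier (tensor C1 A)"
  shows "free_tensor_map f0 ` tensor_map C0 A d K = tensor_map C0' A d' (free_tensor_map f1 ` K)"
proof -
  let ?F0 = "free_tensor_map f0 :: ('c \<times> 'e \<Rightarrow>\<^sub>0 int) \<Rightarrow> _"
  let ?F1 = "free_tensor_map f1 :: ('a \<times> 'e \<Rightarrow>\<^sub>0 int) \<Rightarrow> _"
  let ?D = "free_tensor_map d :: ('a \<times> 'e \<Rightarrow>\<^sub>0 int) \<Rightarrow> _"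
  let ?D' = "free_tensor_map d' :: ('b \<times> 'e \<Rightarrow>\<^sub>0 int) \<Rightarrow> _"
  let ?N0 = "tensor_kernel C0 A" and ?N0' = "tensor_kernel C0' A"
  have sq: "?F0 (?D c) = ?D' (?F1 c)" if "Poly_Mapping.keys c \<subseteq> carrier C1 \<times> carrier A" for c
    using that by (induction c rule: frag_induction) (auto simp: frag_extend_diff comm)
  have "?F0 ` (?N0 #>\<^bsub>free_Abelian_group (carrier C0 \<times> carrier A)\<^esub> ?D c) =
      ?N0' #>\<^bsub>free_Abelian_group (carrier C0' \<times> carrier A)\<^esub> ?D' (?F1 c)" if "c \<in> K" for c
  proof -
    have "Poly_Mapping.keys c \<subseteq> carrier C1 \<times> carrier A"
      using subsetD[OF tensor_carrier_subset[OF mon(1,3) K] that] by simp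
    then have "?F0 ` (?N0 #>\<^bsub>free_Abelian_group (carrier C0 \<times> carrier A)\<^esub> ?D c) =
        ?F0 ` ?N0 #>\<^bsub>free_Abelian_group (carrier C0' \<times> carrier A)\<^esub> ?D' (?F1 c)"
      by (simp add: r_coset_def image_UN frag_extend_add sq)
    then show ?thesis unfolding free_tensor_map_kernel[OF mon(2,3) f0] .
  qed
  then show ?thesis
    unfolding tensor_map_def quot_map_def image_UN image_image by (intro SUP_cong) auto
qed

lemma tensor_map_hom:
  assumes mon: "monoid G" "monoid H" "monoid A" and f: "f \<in> hom G H"
  shows "tensor_map H A f \<in> hom (tensor G A) (tensor H A)"
  unfolding tensor_map_def tensor_def
  by (intro quot_map_hom abelian_free_Abelian_group tensor_kernel_subgroup mon
      free_tensor_map_hom[OF f] free_tensor_map_kernel_subset[OF mon(1,3) f])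

proposition homology_coeff_iso:
  assumes mon: "\<And>k. monoid (C k)" "\<And>k. monoid (C' k)" "monoid A"
    and f: "\<And>k. f k \<in> iso (C k) (C' k)"
    and d: "\<And>k. d k \<in> hom (C k) (C (k - 1))"
    and comm: "\<And>k x. x \<in> carrier (C k) \<Longrightarrow> f (k - 1) (d k x) = d' k (f k x)"
  shows "homology_coeff C d A n \<cong> homology_coeff C' d' A n"
  unfolding homology_coeff_def
proof (rule homology_iso[where f = "\<lambda>k. (`) (free_tensor_map (f k))"])
  show "tensor_map (C (k - 1)) A (d k) K \<in> carrier (tensor (C (k - 1)) A)"
    if "K \<in> carrier (tensor (C k) A)" for k K
    using hom_in_carrier[OF tensor_map_hom[OF mon(1) mon(1) mon(3) d] that] .
  show "free_tensor_map (f (k - 1)) ` tensor_map (C (k - 1)) A (d k) K =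
      tensor_map (C' (k - 1)) A (d' k) (free_tensor_map (f k) ` K)"
    if "K \<in> carrier (tensor (C k) A)" for k K
    by (rule tensor_map_natural[OF mon(1)[of k] mon(1)[of "k - 1"] mon(3) f[of k] f[of "k - 1"]
          _ _ that]) (rule hom_in_carrier[OF d] comm, assumption)+
qed (intro tensor_monoid tensor_iso mon f)+

subsection \<open>Groups of homomorphisms\<close>

text \<open>
  Commutativity of the target is what makes the pointwise product of two homomorphisms a homomorphism.
\<close>

lemma Hom_group_monoid:
  assumes "monoid G" "comm_group A"
  shows "monoid (Hom_group G A)"
proof -
  interpret G: monoid G by (rule assms)
  interpret A: comm_group A by (rule assms)
  show ?thesis
  proof (rule monoidI)
    fix p q assume pq: "p \<in> carrier (Hom_group G A)" "q \<in> carrier (Hom_group G A)"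
    then have p: "p \<in> hom G A" and q: "q \<in> hom G A" by (simp_all add: Hom_group_def)
    have "(\<lambda>x\<in>carrier G. p x \<otimes>\<^bsub>A\<^esub> q x) \<in> hom G A"
      using hom_in_carrier[OF p] hom_in_carrier[OF q]
      by (intro homI) (simp_all add: hom_mult[OF p] hom_mult[OF q] A.m_ac)
    then show "p \<otimes>\<^bsub>Hom_group G A\<^esub> q \<in> carrier (Hom_group G A)" by (simp add: Hom_group_def)
  next
    show "\<one>\<^bsub>Hom_group G A\<^esub> \<in> carrier (Hom_group G A)"
      by (simp add: Hom_group_def hom_def)
  next
    fix p q r assume "p \<in> carrier (Hom_group G A)" "q \<in> carrier (Hom_group G A)"
      "r \<in> carrier (Hom_group G A)"
    then show "p \<otimes>\<^bsub>Hom_group G A\<^esub> q \<otimes>\<^bsub>Hom_group G A\<^esub> r = p \<otimes>\<^bsub>Hom_group G A\<^esub> (q \<otimes>\<^bsub>Hom_group G A\<^esub> r)"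
      by (auto simp: Hom_group_def fun_eq_iff A.m_assoc hom_in_carrier)
  next
    fix p assume p: "p \<in> carrier (Hom_group G A)"
    then have "p x \<in> carrier A" if "x \<in> carrier G" for x
      using that by (simp add: Hom_group_def hom_in_carrier[of p G A])
    with p show "\<one>\<^bsub>Hom_group G A\<^esub> \<otimes>\<^bsub>Hom_group G A\<^esub> p = p" "p \<otimes>\<^bsub>Hom_group G A\<^esub> \<one>\<^bsub>Hom_group G A\<^esub> = p"
      by (auto simp: Hom_group_def extensional_def fun_eq_iff)
  qed
qed

abbreviation Hom_map :: "('a, 'm) monoid_scheme \<Rightarrow> ('a \<Rightarrow> 'c) \<Rightarrow> ('c \<Rightarrow> 'b) \<Rightarrow> 'a \<Rightarrow> 'b" where
  "Hom_map G f \<theta> \<equiv> restrict (\<theta> \<circ> f) (carrier G)"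

lemma Hom_map_closed:
  assumes "f \<in> hom G H" "monoid G" "\<theta> \<in> carrier (Hom_group H A)"
  shows "Hom_map G f \<theta> \<in> carrier (Hom_group G A)"
proof -
  interpret G: monoid G by (rule assms)
  have "\<theta> \<in> hom H A" using assms(3) by (simp add: Hom_group_def)
  then have "\<theta> \<circ> f \<in> hom G A" by (rule hom_compose[OF assms(1)])
  then show ?thesis by (simp add: Hom_group_def hom_def Pi_iff)
qed

lemma Hom_map_hom:
  assumes "f \<in> hom G H" "monoid G"
  shows "Hom_map G f \<in> hom (Hom_group H A) (Hom_group G A)"
  using hom_in_carrier[OF assms(1)] Hom_map_closed[OF assms]
  by (intro homI) (auto simp: Hom_group_def fun_eq_iff)

lemma Hom_map_compose:
  assumes "f \<in> hom G H"
  shows "Hom_map G f (Hom_map H g \<theta>) = Hom_map G (g \<circ> f) \<theta>"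
  using hom_in_carrier[OF assms] by (auto simp: fun_eq_iff)

lemma Hom_map_id:
  assumes "\<theta> \<in> carrier (Hom_group G A)" "\<And>x. x \<in> carrier G \<Longrightarrow> f x = x"
  shows "Hom_map G f \<theta> = \<theta>"
  using assms by (auto simp: Hom_group_def extensional_def fun_eq_iff)

lemma Hom_map_iso:
  assumes "group_isomorphisms G H f g" "monoid G" "monoid H"
  shows "Hom_map H g \<in> iso (Hom_group G A) (Hom_group H A)"
proof -
  have fg: "f \<in> hom G H" "g \<in> hom H G" "\<And>x. x \<in> carrier G \<Longrightarrow> g (f x) = x"
    "\<And>y. y \<in> carrier H \<Longrightarrow> f (g y) = y"
    using assms(1) by (auto simp: group_isomorphisms_def)
  have "group_isomorphisms (Hom_group G A) (Hom_group H A) (Hom_map H g) (Hom_map G f)"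
    unfolding group_isomorphisms_def
    using fg assms(2,3) by (simp add: Hom_map_hom Hom_map_compose Hom_map_id)
  then show ?thesis by (rule group_isomorphisms_imp_iso)
qed

text \<open>
  Being contravariant, \<open>Hom\<close> turns the inverse isomorphisms \<open>g\<close> into the comparison maps; this is why
  both directions are given here, and why \<open>g\<close> is first shown to commute with the differentials.
\<close>

proposition cohomology_coeff_iso:
  assumes mon: "\<And>k. monoid (C k)" "\<And>k. monoid (C' k)" "comm_group A"
    and fg: "\<And>k. group_isomorphisms (C k) (C' k) (f k) (g k)"
    and d: "\<And>k. d k \<in> hom (C k) (C (k - 1))"
    and comm: "\<And>k x. x \<in> carrier (C k) \<Longrightarrow> f (k - 1) (d k x) = d' k (f k x)"
  shows "cohomology_coeff C d A n \<cong> cohomology_coeff C' d' A n"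
proof -
  have g: "g k \<in> hom (C' k) (C k)" and gf: "\<And>x. x \<in> carrier (C k) \<Longrightarrow> g k (f k x) = x"
    and f_g: "\<And>y. y \<in> carrier (C' k) \<Longrightarrow> f k (g k y) = y" for k
    using fg[of k] by (auto simp: group_isomorphisms_def)
  have g_d: "d k (g k y) = g (k - 1) (d' k y) \<and> d' k y \<in> carrier (C' (k - 1))"
    if "y \<in> carrier (C' k)" for k y
  proof -
    have x: "g k y \<in> carrier (C k)" using g that by (rule hom_in_carrier)
    then have *: "f (k - 1) (d k (g k y)) = d' k y" using comm[OF x] f_g[OF that] by simp
    have "f (k - 1) \<in> hom (C (k - 1)) (C' (k - 1))" using fg[of "k - 1"] by (simp add: group_isomorphisms_def)
    then show ?thesis
      using gf[OF hom_in_carrier[OF d x]] hom_in_carrier[OF _ hom_in_carrier[OF d x]] * by metis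
  qed
  have d_at: "d (- k + 1) \<in> hom (C (- k + 1)) (C (- k))" for k using d[of "- k + 1"] by simp
  have comm': "Hom_map (C' (- k + 1)) (g (- k + 1)) (Hom_map (C (- k + 1)) (d (- k + 1)) \<theta>) =
      Hom_map (C' (- k + 1)) (d' (- k + 1)) (Hom_map (C' (- k)) (g (- k)) \<theta>)" for k \<theta>
    using g_d[of _ "- k + 1"] hom_in_carrier[OF g[of "- k + 1"]] by (auto simp: fun_eq_iff)
  have shift: "- (k - 1) = - k + 1" for k :: int by simp
  show ?thesis
    unfolding cohomology_coeff_def cohomology_eq_homology
  proof (rule homology_iso[where f = "\<lambda>k. Hom_map (C' (- k)) (g (- k))"], unfold shift)
    show "Hom_map (C' (- k)) (g (- k)) \<in> iso (Hom_group (C (- k)) A) (Hom_group (C' (- k)) A)" for k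
      by (rule Hom_map_iso[OF fg mon(1,2)])
    show "Hom_map (C (- k + 1)) (d (- k + 1)) \<theta> \<in> carrier (Hom_group (C (- k + 1)) A)"
      if "\<theta> \<in> carrier (Hom_group (C (- k)) A)" for k \<theta>
      by (rule Hom_map_closed[OF d_at mon(1) that])
  qed (rule Hom_group_monoid comm' mon)+
qed

section \<open>Chains in free Abelian groups\<close>

text \<open>
  Membership in a subgroup spanned by basis elements is a condition on the support, which makes the
  degenerate chains easy to recognise.
\<close>

lemma generate_frag_of:
  fixes S T :: "'a set"
  assumes "T \<subseteq> S"
  shows "generate (free_Abelian_group S) (frag_of ` T) = {c. Poly_Mapping.keys c \<subseteq> T}"
proof (intro equalityI subsetI)
  fix c assume "c \<in> generate (free_Abelian_group S) (frag_of ` T)"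
  then show "c \<in> {c. Poly_Mapping.keys c \<subseteq> T}"
  proof induction
    case (inv h)
    then show ?case using assms by auto
  next
    case (eng a b)
    then show ?case using keys_add[of a b] by auto
  qed auto
next
  let ?G = "generate (free_Abelian_group S) (frag_of ` T)"
  have sub: "frag_of ` T \<subseteq> carrier (free_Abelian_group S)" using assms by auto
  fix c :: "'a \<Rightarrow>\<^sub>0 int" assume "c \<in> {c. Poly_Mapping.keys c \<subseteq> T}"
  then have "Poly_Mapping.keys c \<subseteq> T" by simp
  then show "c \<in> ?G"
  proof (induction c rule: frag_induction)
    case zero
    then show ?case using generate.one[of "free_Abelian_group S"] by simp
  next
    case (one x)
    then show ?case by (intro generate.incl) simp
  next
    case (diff a b)
    have "b \<in> carrier (free_Abelian_group S)"
      using group.generate_in_carrier[OF group_free_Abelian_group sub] diff(2) by blast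
    then have "- b \<in> ?G"
      using group.generate_m_inv_closed[OF group_free_Abelian_group sub diff(2)] by simp
    from generate.eng[OF diff(1) this] show ?case by simp
  qed
qed

definition map_frag :: "('b \<Rightarrow> 'c) \<Rightarrow> ('b \<Rightarrow>\<^sub>0 int) \<Rightarrow> ('c \<Rightarrow>\<^sub>0 int)" where
  "map_frag f = frag_extend (frag_of \<circ> f)"

lemma map_frag_simps [simp]:
  "map_frag f 0 = 0" "map_frag f (frag_of b) = frag_of (f b)"
  "map_frag f (- c) = - map_frag f c"
  "map_frag f (c + d) = map_frag f c + map_frag f d"
  "map_frag f (c - d) = map_frag f c - map_frag f d"
  "map_frag f (frag_cmul k c) = frag_cmul k (map_frag f c)"
  by (simp_all add: map_frag_def frag_extend_minus frag_extend_add frag_extend_diff frag_extend_cmul)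

lemma frag_cmul_diff_right: "frag_cmul k (c - d) = frag_cmul k c - frag_cmul k d"
  by (rule poly_mapping_eqI) (simp add: lookup_minus right_diff_distrib)

lemma map_frag_compose: "map_frag f (map_frag g c) = map_frag (f \<circ> g) c"
  by (simp add: map_frag_def frag_extend_compose comp_assoc)

lemma keys_map_frag: "Poly_Mapping.keys (map_frag f c) \<subseteq> f ` Poly_Mapping.keys c"
  unfolding map_frag_def using keys_frag_extend[of "frag_of \<circ> f" c] by auto

lemma free_Abelian_subgroup_diff:
  assumes "subgroup M (free_Abelian_group S)" "a \<in> M" "b \<in> M"
  shows "a - b \<in> M"
proof -
  interpret subgroup M "free_Abelian_group S" by (rule assms)
  have "- b \<in> M" using m_inv_closed[OF assms(3)] mem_carrier[OF assms(3)] by simp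
  with m_closed[OF assms(2)] show ?thesis by fastforce
qed

lemma (in group_hom) generate_into_subgroup:
  assumes "K \<subseteq> carrier G" "subgroup M H" "h ` K \<subseteq> M"
  shows "h ` generate G K \<subseteq> M"
  using generate_img[OF assms(1)] H.generate_subgroup_incl[OF assms(3,2)] by simp

section \<open>The boundary, one letter at a time\<close>

text \<open>
  The formula for the boundary of a single generator, in every length. In length one it need not
  vanish, in contrast to the boundary itself; this uniformity is what the recursion on the last letter
  needs.
\<close>

definition faces :: "('y \<Rightarrow> 'x \<Rightarrow> 'y) \<Rightarrow> ('x \<Rightarrow> 'x \<Rightarrow> 'x) \<Rightarrow> 'y \<times> 'x list \<Rightarrow> ('y \<times> 'x list \<Rightarrow>\<^sub>0 int)" where
  "faces \<alpha> q = (\<lambda>(r, xs). \<Sum>i<length xs. frag_cmul ((-1) ^ (i + 1))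
          (frag_of (r, take i xs @ drop (i + 1) xs)
           - frag_of (\<alpha> r (xs ! i), map (\<lambda>x. q x (xs ! i)) (take i xs) @ drop (i + 1) xs)))"

lemma bdry_faces:
  "bdry X qop act n = (if n > 1 then frag_extend (faces (gen_act X qop act) qop) else (\<lambda>_. 0))"
  by (simp add: bdry_def faces_def)

definition snoc :: "'x \<Rightarrow> 'y \<times> 'x list \<Rightarrow> 'y \<times> 'x list" where
  "snoc x b = (fst b, snd b @ [x])"

lemma length_snoc [simp]: "length (snd (snoc x b)) = Suc (length (snd b))"
  by (simp add: snoc_def)

lemma faces_Nil [simp]: "faces \<alpha> q (r, []) = 0"
  by (simp add: faces_def)

text \<open>
  The faces that remove one of the letters of \<open>xs\<close> leave the last letter \<open>x\<close> alone; the remaining face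
  removes \<open>x\<close>, and its second summand lets \<open>x\<close> act on everything else.
\<close>

lemma faces_snoc:
  "faces \<alpha> q (r, xs @ [x]) = map_frag (snoc x) (faces \<alpha> q (r, xs))
     + frag_cmul ((-1) ^ (length xs + 1))
        (frag_of (r, xs) - frag_of (\<alpha> r x, map (\<lambda>z. q z x) xs))"
  by (simp add: faces_def map_frag_def frag_extend_sum frag_extend_cmul frag_extend_diff snoc_def nth_append comp_def)

lemma faces_cong:
  assumes "\<And>x. x \<in> set xs \<Longrightarrow> \<alpha> r x = \<beta> r x"
  shows "faces \<alpha> q (r, xs) = faces \<beta> q (r, xs)"
  using assms by (simp add: faces_def)

lemma keys_faces:
  assumes "b \<in> Y \<times> lists X" and \<alpha>: "\<And>r x. r \<in> Y \<Longrightarrow> x \<in> X \<Longrightarrow> \<alpha> r x \<in> Y"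
    and q: "\<And>x y. x \<in> X \<Longrightarrow> y \<in> X \<Longrightarrow> q x y \<in> X"
  shows "Poly_Mapping.keys (faces \<alpha> q b) \<subseteq> {c \<in> Y \<times> lists X. length (snd c) = length (snd b) - 1}"
proof -
  obtain r xs where b: "b = (r, xs)" "r \<in> Y" "set xs \<subseteq> X" using assms(1) by (auto simp: lists_eq_set)
  have sub: "set (take i xs) \<subseteq> X" "set (drop i xs) \<subseteq> X" for i
    using order_trans[OF set_take_subset b(3)] order_trans[OF set_drop_subset b(3)] by blast+
  have "Poly_Mapping.keys (frag_cmul k (frag_of (r, take i xs @ drop (i + 1) xs)
      - frag_of (\<alpha> r (xs ! i), map (\<lambda>x. q x (xs ! i)) (take i xs) @ drop (i + 1) xs)))
      \<subseteq> {c \<in> Y \<times> lists X. length (snd c) = length (snd b) - 1}" if "i < length xs" for i k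
  proof -
    have "xs ! i \<in> X" using subsetD[OF b(3) nth_mem[OF that]] .
    then have "map (\<lambda>x. q x (xs ! i)) (take i xs) \<in> lists X" "\<alpha> r (xs ! i) \<in> Y"
      using sub(1)[of i] b(2) by (auto simp: lists_eq_set intro: \<alpha> q)
    moreover have "take i xs \<in> lists X" "drop (i + 1) xs \<in> lists X"
      using sub by (simp_all add: lists_eq_set)
    ultimately show ?thesis
      using b that by (intro order_trans[OF keys_cmul] order_trans[OF keys_diff]) simp
  qed
  then show ?thesis
    unfolding b(1) faces_def prod.case by (intro order_trans[OF keys_sum] UN_least) (simp add: b(1))
qed

definition adjacent_equal :: "'x list \<Rightarrow> bool" where
  "adjacent_equal xs \<longleftrightarrow> (\<exists>i. i + 1 < length xs \<and> xs ! i = xs ! (i + 1))"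

lemma adjacent_equal_Nil [simp]: "\<not> adjacent_equal []"
  by (simp add: adjacent_equal_def)

lemma adjacent_equal_snoc:
  "adjacent_equal (xs @ [x]) \<longleftrightarrow> adjacent_equal xs \<or> (\<exists>zs. xs = zs @ [x])"
proof
  assume "adjacent_equal (xs @ [x])"
  then obtain i where i: "i < length xs" "(xs @ [x]) ! i = (xs @ [x]) ! Suc i"
    by (auto simp: adjacent_equal_def)
  show "adjacent_equal xs \<or> (\<exists>zs. xs = zs @ [x])"
  proof (cases "Suc i < length xs")
    case True
    then show ?thesis using i by (auto simp: adjacent_equal_def nth_append)
  next
    case False
    then have "length xs = Suc i" using i by simp
    then have "xs ! i = x" "xs = take i xs @ [xs ! i]"
      using i(2) by (auto simp: nth_append take_Suc_conv_app_nth[symmetric])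
    then show ?thesis by metis
  qed
next
  assume "adjacent_equal xs \<or> (\<exists>zs. xs = zs @ [x])"
  then show "adjacent_equal (xs @ [x])"
  proof
    assume "adjacent_equal xs"
    then obtain i where "i + 1 < length xs" "xs ! i = xs ! (i + 1)" by (auto simp: adjacent_equal_def)
    then show ?thesis unfolding adjacent_equal_def by (intro exI[of _ i]) (auto simp: nth_append)
  next
    assume "\<exists>zs. xs = zs @ [x]"
    then obtain zs where "xs = zs @ [x]" by blast
    then show ?thesis unfolding adjacent_equal_def
      by (intro exI[of _ "length zs"]) (simp add: nth_append)
  qed
qed

lemma adjacent_equal_map: "adjacent_equal xs \<Longrightarrow> adjacent_equal (map f xs)"
  by (auto simp: adjacent_equal_def)

lemma degen_generators:
  "degen X Y n = generate (chain_group X Y n) (frag_of ` {b \<in> chain_basis X Y n. adjacent_equal (snd b)})"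
proof -
  have "{frag_of (r, xs) | r xs. (r, xs) \<in> chain_basis X Y n \<and>
        (\<exists>i. i + 1 < length xs \<and> xs ! i = xs ! (i + 1))}
      = frag_of ` {b \<in> chain_basis X Y n. adjacent_equal (snd b)}"
    unfolding adjacent_equal_def
    by (intro equalityI subsetI; elim CollectE exE conjE imageE)
      (auto intro!: imageI, metis prod.collapse)
  then show ?thesis unfolding degen_def by simp
qed

lemma degen_eq:
  "degen X Y n = {c. Poly_Mapping.keys c \<subseteq> {b \<in> chain_basis X Y n. adjacent_equal (snd b)}}"
  unfolding degen_generators chain_group_def by (rule generate_frag_of) blast

section \<open>The action of letters on generators\<close>

locale quandle_action = quandle X qop
  for X :: "'x set" and qop :: "'x \<Rightarrow> 'x \<Rightarrow> 'x" +
  fixes Y :: "'y set" and act :: "'y \<Rightarrow> 'x word set \<Rightarrow> 'y"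
  assumes action: "quandle_set X qop Y act"
begin

text \<open>
  A letter \<open>(x, e)\<close> plays two roles: it is an element of the double, and it stands for the element
  \<open>x\<^sup>e\<close> of the associated group of \<open>X\<close>. The action of the double is, by definition, through the latter
  (\<open>gen_act_double\<close>).
\<close>

definition letter_act :: "'y \<Rightarrow> 'x \<times> sign \<Rightarrow> 'y" where
  "letter_act r l = act r (word_class X (quandle_rels X qop) [l])"

lemma act_word_append:
  assumes "r \<in> Y" "u \<in> words X" "v \<in> words X"
  shows "act (act r (word_class X (quandle_rels X qop) u)) (word_class X (quandle_rels X qop) v)
    = act r (word_class X (quandle_rels X qop) (u @ v))"
proof -
  interpret right_action "assoc_group X qop" Y act by (rule action)
  have "word_class X (quandle_rels X qop) w \<in> carrier (assoc_group X qop)" if "w \<in> words X" for w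
    using that by (simp add: assoc_group_def presented_group_def)
  then show ?thesis
    using act_mult[OF assms(1), of "word_class X (quandle_rels X qop) u" "word_class X (quandle_rels X qop) v"]
      assms word_class_mult[OF quandle_rels_words] by (simp add: assoc_group_def)
qed

lemma letter_act_closed: "\<lbrakk>r \<in> Y; x \<in> X\<rbrakk> \<Longrightarrow> letter_act r (x, e) \<in> Y"
  using right_action.act_closed[OF action]
  by (auto simp: letter_act_def assoc_group_def presented_group_def)

lemma letter_act_flip:
  assumes "r \<in> Y" "x \<in> X"
  shows "letter_act (letter_act r (x, e)) (x, flip e) = r"
proof -
  have "word_eq X (quandle_rels X qop) [(x, e), (x, flip e)] []"
    using word_eq.cancel[of "[]" X "[]" x "quandle_rels X qop" e] assms by simp
  then have "word_class X (quandle_rels X qop) [(x, e), (x, flip e)] = \<one>\<^bsub>assoc_group X qop\<^esub>"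
    using word_class_eq[OF quandle_rels_words] by (simp add: assoc_group_def presented_group_def)
  then show ?thesis
    using act_word_append[of r "[(x, e)]" "[(x, flip e)]"] right_action.act_one[OF action] assms
    by (simp add: letter_act_def)
qed

text \<open>
  In the associated group, \<open>x * y\<^sup>e = y\<^sup>-\<^sup>e x y\<^sup>e\<close>, hence \<open>x y\<^sup>e = y\<^sup>e (x * y\<^sup>e)\<close>, and likewise for the inverse
  of \<open>x\<close>.
\<close>

lemma letter_act_distrib:
  assumes "r \<in> Y" "x \<in> X" "y \<in> X"
  shows "letter_act (letter_act r (x, d)) (y, e)
    = letter_act (letter_act r (y, e)) (signed_op X qop x y e, d)"
proof -
  let ?R = "quandle_rels X qop" and ?z = "signed_op X qop x y e"
  have z: "?z \<in> X" using assms signed_op_closed by blast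
  have "word_eq X ?R ([(y, e)] @ [(?z, d)] @ []) ([(y, e)] @ [(y, flip e), (x, d), (y, e)] @ [])"
    by (rule word_eq_ctxt[OF quandle_rels_words word_eq_signed_op]) (use assms in auto)
  moreover have "word_eq X ?R ([(y, e)] @ [(y, flip e), (x, d), (y, e)] @ []) [(x, d), (y, e)]"
    using word_eq.cancel[of "[]" X "[(x, d), (y, e)]" y ?R e] assms by simp
  ultimately have "word_class X ?R ([(y, e)] @ [(?z, d)]) = word_class X ?R ([(x, d)] @ [(y, e)])"
    using word_class_eq[OF quandle_rels_words] word_eq.trans by fastforce
  then show ?thesis
    using act_word_append[of r "[(x, d)]" "[(y, e)]"] act_word_append[of r "[(y, e)]" "[(?z, d)]"] assms z
    by (simp add: letter_act_def)
qed

lemma gen_act_letter: "gen_act X qop act = (\<lambda>r x. letter_act r (x, Pos))"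
  by (simp add: fun_eq_iff gen_act_def letter_act_def pres_gen_def)

abbreviation double_set_act where
  "double_set_act \<equiv> underlying_act (double X) (double_op X qop) double_inv (double_act X qop act)"

text \<open>
  The action travels from the associated group of the double to its symmetric quotient and from there,
  by the homomorphism \<open>\<pi>\<close>, to the associated group of \<open>X\<close>; on a generator this gives the letter itself.
\<close>

lemma gen_act_double:
  assumes "l \<in> double X"
  shows "gen_act (double X) (double_op X qop) double_set_act r l = letter_act r l"
proof -
  obtain x e where l: "l = (x, e)" "x \<in> X" using assms by (auto simp: double_def)
  interpret D: symmetric_quandle "double X" "double_op X qop" double_inv
    by (rule double_symmetric_quandle)
  let ?R = "quandle_rels (double X) (double_op X qop)"
  let ?S = "symm_rels (double X) (double_op X qop) double_inv"
  have id: "letter_map (\<lambda>l. (l, Pos)) w = w" for w :: "('x \<times> sign) word"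
    by (induction w) auto
  have rel: "word_eq (double X) ?S p q" if "(p, q) \<in> ?R" for p q
    using word_eq.rel[of "[]" "double X" "[]" p q ?S] that by (simp add: symm_rels_def)
  have "pres_hom (double X) ?S (\<lambda>l. (l, Pos)) (word_class (double X) ?R [((x, e), Pos)])
      = word_class (double X) ?S (letter_map (\<lambda>l. (l, Pos)) [((x, e), Pos)])"
    by (rule pres_hom_class[OF D.quandle_rels_words D.symm_rels_words]) (use assms l in \<open>auto simp: id rel\<close>)
  then show ?thesis
    using double_proj_gen[OF l(2), of e]
    by (simp add: l(1) gen_act_def pres_gen_def underlying_act_def double_act_def letter_act_def)
qed

text \<open>
  The diagonal action of a letter on a whole generator, over \<open>X\<close> and over the double. Over the double
  the signs of the letters acted upon stay the same.
\<close>

definition push :: "'x \<times> sign \<Rightarrow> 'y \<times> 'x list \<Rightarrow> 'y \<times> 'x list" where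
  "push l b = (letter_act (fst b) l, map (\<lambda>x. signed_op X qop x (fst l) (snd l)) (snd b))"

definition pushD :: "'x \<times> sign \<Rightarrow> 'y \<times> ('x \<times> sign) list \<Rightarrow> 'y \<times> ('x \<times> sign) list" where
  "pushD l b = (letter_act (fst b) l, map (\<lambda>y. double_op X qop y l) (snd b))"

abbreviation facesX where "facesX \<equiv> faces (\<lambda>r x. letter_act r (x, Pos)) qop"
abbreviation facesD where "facesD \<equiv> faces letter_act (double_op X qop)"

lemma length_push [simp]: "length (snd (push l b)) = length (snd b)"
  by (simp add: push_def)

lemma push_closed: "\<lbrakk>b \<in> Y \<times> lists X; x \<in> X\<rbrakk> \<Longrightarrow> push (x, e) b \<in> Y \<times> lists X"
  by (auto simp: push_def letter_act_closed signed_op_closed in_lists_conv_set)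

lemma snoc_closed: "\<lbrakk>b \<in> Y \<times> lists X; x \<in> X\<rbrakk> \<Longrightarrow> snoc x b \<in> Y \<times> lists X"
  by (auto simp: snoc_def)

lemma push_snoc: "push (y, e) (snoc x b) = snoc (signed_op X qop x y e) (push (y, e) b)"
  by (simp add: push_def snoc_def)

lemma push_flip:
  assumes "b \<in> Y \<times> lists X" "x \<in> X"
  shows "push (x, flip e) (push (x, e) b) = b"
proof -
  have "signed_op X qop (signed_op X qop z x e) x (flip e) = z" if "z \<in> X" for z
    using signed_op_flip[OF that assms(2), of "flip e"] by simp
  then show ?thesis
    using assms by (auto simp: push_def letter_act_flip in_lists_conv_set intro!: map_idI)
qed

lemma push_distrib:
  assumes "b \<in> Y \<times> lists X" "x \<in> X" "y \<in> X"
  shows "push (y, e) (push (x, d) b) = push (signed_op X qop x y e, d) (push (y, e) b)"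
  using assms letter_act_distrib[of "fst b" x y d e] signed_op_distrib[of _ x y d e]
  by (auto simp: push_def in_lists_conv_set)

lemma pushD_snoc:
  "pushD l (r, ys @ [(x, e)]) = snoc (signed_op X qop x (fst l) (snd l), e) (pushD l (r, ys))"
  by (cases l) (simp add: pushD_def snoc_def)

lemma facesX_snoc:
  "facesX (snoc x b) = map_frag (snoc x) (facesX b)
     + frag_cmul ((-1) ^ (length (snd b) + 1)) (frag_of b - frag_of (push (x, Pos) b))"
  using faces_snoc[of "\<lambda>r x. letter_act r (x, Pos)" qop "fst b" "snd b" x]
  by (simp add: snoc_def[of x b] push_def)

lemma facesD_snoc:
  "facesD (snoc l b) = map_frag (snoc l) (facesD b)
     + frag_cmul ((-1) ^ (length (snd b) + 1)) (frag_of b - frag_of (pushD l b))"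
  using faces_snoc[of letter_act "double_op X qop" "fst b" "snd b" l]
  by (simp add: snoc_def[of l b] pushD_def)

lemma basis_induct [consumes 1, case_names Nil snoc]:
  assumes "b \<in> Y \<times> lists Z"
    and "\<And>r. r \<in> Y \<Longrightarrow> P (r, [])"
    and "\<And>b x. \<lbrakk>b \<in> Y \<times> lists Z; x \<in> Z; P b\<rbrakk> \<Longrightarrow> P (snoc x b)"
  shows "P b"
proof -
  have "P (r, xs)" if "r \<in> Y" "set xs \<subseteq> Z" for r xs
    using that
  proof (induction xs rule: rev_induct)
    case Nil
    then show ?case using assms(2) by simp
  next
    case (snoc x xs)
    then show ?case using assms(3)[of "(r, xs)" x] by (auto simp: snoc_def)
  qed
  then show ?thesis using assms(1) by (auto simp: lists_eq_set)
qed

text \<open>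
  The boundary is equivariant: by \<open>push_distrib\<close>, translating by \<open>y\<close> turns the action of \<open>x\<close> into the
  action of \<open>x * y\<close>, which is the translated letter.
\<close>

lemma facesX_push:
  assumes "b \<in> Y \<times> lists X" "y \<in> X"
  shows "facesX (push (y, e) b) = map_frag (push (y, e)) (facesX b)"
  using assms(1)
proof (induction rule: basis_induct)
  case (Nil r)
  then show ?case by (simp add: push_def)
next
  case (snoc b x)
  have "map_frag (push (y, e)) (map_frag (snoc x) c) =
      map_frag (snoc (signed_op X qop x y e)) (map_frag (push (y, e)) c)" for c
    by (simp add: map_frag_compose comp_def push_snoc)
  then show ?case
    using snoc push_distrib[OF snoc(1,2) assms(2), of e Pos]
    by (simp add: push_snoc facesX_snoc)
qed

text \<open>
  If the last two letters are both \<open>x\<close>, the two faces that remove one of them cancel because \<open>x * x = x\<close>,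
  and all others still end in \<open>x, x\<close>. Equal letters further to the left are covered by induction,
  since the face that removes the last letter keeps them adjacent and equal.
\<close>

lemma keys_facesX_degenerate:
  assumes "b \<in> Y \<times> lists X" "adjacent_equal (snd b)"
  shows "Poly_Mapping.keys (facesX b) \<subseteq> {c. adjacent_equal (snd c)}"
  using assms
proof (induction rule: basis_induct)
  case (Nil r)
  then show ?case by simp
next
  case (snoc b x)
  from snoc.prems consider "adjacent_equal (snd b)" | zs where "snd b = zs @ [x]"
    by (auto simp: snoc_def adjacent_equal_snoc)
  then show ?case
  proof cases
    case 1
    then have "adjacent_equal (snd (push (x, Pos) b))" by (simp add: push_def adjacent_equal_map)
    moreover have "Poly_Mapping.keys (map_frag (snoc x) (facesX b)) \<subseteq> {c. adjacent_equal (snd c)}"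
      using order_trans[OF keys_map_frag image_mono[OF snoc.IH[OF 1]], of "snoc x"]
      by (auto simp: snoc_def adjacent_equal_snoc)
    ultimately show ?thesis
      unfolding facesX_snoc using 1
      by (intro order_trans[OF keys_add] Un_least order_trans[OF keys_cmul] order_trans[OF keys_diff])
        auto
  next
    case 2
    define a where "a = (fst b, zs)"
    have b: "b = snoc x a" using 2 by (cases b) (simp add: a_def snoc_def)
    have "push (x, Pos) (snoc x a) = snoc x (push (x, Pos) a)"
      using push_snoc[of x Pos x a] Q1[OF snoc.hyps(2)] by simp
    then have "facesX (snoc x b) = map_frag (snoc x) (map_frag (snoc x) (facesX a))"
      unfolding b by (simp add: facesX_snoc flip: frag_cmul_distrib)
    moreover have "adjacent_equal (snd (snoc x (snoc x c)))" for c :: "'y \<times> 'x list"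
      using adjacent_equal_snoc[of "snd c @ [x]" x] by (simp add: snoc_def)
    ultimately show ?thesis
      using order_trans[OF keys_map_frag[of "snoc x" "map_frag (snoc x) (facesX a)"]
          image_mono[OF keys_map_frag[of "snoc x" "facesX a"]]] by auto
  qed
qed

section \<open>Making all letters positive\<close>

text \<open>
  One step of the replacement of negative letters, for a generator whose earlier letters are already
  positive: a new negative letter \<open>x\<close> acts on all of them and then becomes positive. The sign is kept
  separately in \<open>parity\<close>.
\<close>

fun add_letter :: "'y \<times> 'x list \<Rightarrow> 'x \<times> sign \<Rightarrow> 'y \<times> 'x list" where
  "add_letter b (x, Pos) = snoc x b"
| "add_letter b (x, Neg) = snoc x (push (x, Neg) b)"

definition positive_form :: "'y \<times> ('x \<times> sign) list \<Rightarrow> 'y \<times> 'x list" where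
  "positive_form b = foldl add_letter (fst b, []) (snd b)"

definition parity :: "'y \<times> ('x \<times> sign) list \<Rightarrow> int" where
  "parity b = (\<Prod>l\<leftarrow>snd b. if snd l = Pos then 1 else -1)"

definition to_positive :: "('y \<times> ('x \<times> sign) list \<Rightarrow>\<^sub>0 int) \<Rightarrow> ('y \<times> 'x list \<Rightarrow>\<^sub>0 int)" where
  "to_positive = frag_extend (\<lambda>b. frag_cmul (parity b) (frag_of (positive_form b)))"

lemma to_positive_simps [simp]:
  "to_positive 0 = 0" "to_positive (frag_of b) = frag_cmul (parity b) (frag_of (positive_form b))"
  "to_positive (c + d) = to_positive c + to_positive d"
  "to_positive (c - d) = to_positive c - to_positive d"
  "to_positive (frag_cmul k c) = frag_cmul k (to_positive c)"
  by (simp_all add: to_positive_def frag_extend_add frag_extend_diff frag_extend_cmul)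

lemma positive_form_simps [simp]:
  "positive_form (r, []) = (r, [])"
  "positive_form (snoc l b) = add_letter (positive_form b) l"
  by (simp_all add: positive_form_def snoc_def)

lemma parity_simps [simp]:
  "parity (r, []) = 1"
  "parity (snoc l b) = (if snd l = Pos then parity b else - parity b)"
  by (simp_all add: parity_def snoc_def)

lemma add_letter_closed:
  "\<lbrakk>b \<in> Y \<times> lists X; l \<in> double X\<rbrakk> \<Longrightarrow> add_letter b l \<in> Y \<times> lists X"
  by (cases "(b, l)" rule: add_letter.cases) (auto simp: double_def snoc_closed push_closed)

lemma length_add_letter [simp]: "length (snd (add_letter b l)) = Suc (length (snd b))"
  by (cases "(b, l)" rule: add_letter.cases) auto

lemma positive_form_basis:
  assumes "b \<in> Y \<times> lists (double X)"
  shows positive_form_closed: "positive_form b \<in> Y \<times> lists X"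
    and length_positive_form: "length (snd (positive_form b)) = length (snd b)"
  using assms by (induction rule: basis_induct) (auto simp: add_letter_closed)

text \<open>
  The induction step for a negative letter \<open>x\<close> is the commutation rule \<open>push_distrib\<close> for the inverse
  of \<open>x\<close>.
\<close>

lemma positive_form_pushD:
  assumes "b \<in> Y \<times> lists (double X)" "y \<in> X"
  shows "positive_form (pushD (y, e) b) = push (y, e) (positive_form b)"
  using assms(1)
proof (induction rule: basis_induct)
  case (Nil r)
  then show ?case by (simp add: pushD_def push_def)
next
  case (snoc b l)
  obtain x d where l: "l = (x, d)" "x \<in> X" using snoc(2) by (auto simp: double_def)
  have "pushD (y, e) (snoc l b) = snoc (signed_op X qop x y e, d) (pushD (y, e) b)"
    using pushD_snoc[of "(y, e)" "fst b" "snd b" x d] by (simp add: l snoc_def[of _ b])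
  then show ?case
    using snoc.IH push_distrib[OF positive_form_closed[OF snoc(1)] l(2) assms(2), of e Neg]
    by (cases d) (simp_all add: l push_snoc)
qed

lemma parity_pushD [simp]: "parity (pushD l b) = parity b"
proof -
  have "snd (double_op X qop y l) = snd y" for y by (cases y; cases l) simp
  then show ?thesis by (simp add: parity_def pushD_def comp_def)
qed

lemma to_positive_snoc:
  "to_positive (map_frag (snoc (x, Pos)) c) = map_frag (snoc x) (to_positive c)"
  "to_positive (map_frag (snoc (x, Neg)) c) = - map_frag (snoc x) (map_frag (push (x, Neg)) (to_positive c))"
proof -
  have "to_positive (map_frag (snoc (x, Pos)) c) = map_frag (snoc x) (to_positive c) \<and>
    to_positive (map_frag (snoc (x, Neg)) c) = - map_frag (snoc x) (map_frag (push (x, Neg)) (to_positive c))"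
    using subset_UNIV by (induction c rule: frag_induction) (auto simp: algebra_simps)
  then show "to_positive (map_frag (snoc (x, Pos)) c) = map_frag (snoc x) (to_positive c)"
    "to_positive (map_frag (snoc (x, Neg)) c) = - map_frag (snoc x) (map_frag (push (x, Neg)) (to_positive c))"
    by auto
qed

text \<open>
  The boundaries agree letter by letter. For a negative last letter \<open>x\<close>, let \<open>p\<close> be the positive form of
  what precedes it. Over the double the face removing \<open>x\<close> gives \<open>p - push (x, Neg) p\<close>. Over \<open>X\<close> the
  generator is \<open>push (x, Neg) p\<close> followed by the positive letter \<open>x\<close>, so the same face gives
  \<open>push (x, Neg) p - p\<close>: the opposite, as the change of parity requires.
\<close>

lemma to_positive_facesD:
  assumes "b \<in> Y \<times> lists (double X)"
  shows "to_positive (facesD b) = frag_cmul (parity b) (facesX (positive_form b))"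
  using assms
proof (induction rule: basis_induct)
  case (Nil r)
  then show ?case by simp
next
  case (snoc b l)
  obtain x d where l: "l = (x, d)" "x \<in> X" using snoc(2) by (auto simp: double_def)
  let ?p = "positive_form b" and ?s = "parity b" and ?k = "(-1) ^ (length (snd b) + 1) :: int"
  note p = positive_form_closed[OF snoc(1)]
  have exp: "to_positive (facesD (snoc l b)) = to_positive (map_frag (snoc l) (facesD b))
      + frag_cmul ?k (frag_cmul ?s (frag_of ?p) - frag_cmul ?s (frag_of (push l ?p)))"
    using positive_form_pushD[OF snoc(1) l(2), of d] by (simp add: facesD_snoc l(1))
  show ?case
  proof (cases d)
    case Pos
    show ?thesis
      unfolding exp using snoc.IH length_positive_form[OF snoc(1)]
      by (simp add: l Pos to_positive_snoc facesX_snoc frag_cmul_diff_right frag_cmul_distrib2 mult.commute)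
  next
    case Neg
    have "push (x, Pos) (push (x, Neg) ?p) = ?p" using push_flip[OF p l(2), of Neg] by simp
    then show ?thesis
      unfolding exp using snoc.IH length_positive_form[OF snoc(1)] facesX_push[OF p l(2), of Neg]
      by (simp add: l Neg to_positive_snoc facesX_snoc frag_cmul_diff_right frag_cmul_distrib2 mult.commute)
        (simp flip: minus_frag_cmul)
  qed
qed

lemma to_positive_boundary:
  assumes "Poly_Mapping.keys c \<subseteq> Y \<times> lists (double X)"
  shows "to_positive (frag_extend facesD c) = frag_extend facesX (to_positive c)"
  using assms
  by (induction c rule: frag_induction)
    (simp_all only: frag_extend_0 frag_extend_of frag_extend_diff frag_extend_cmul to_positive_simps to_positive_facesD)

section \<open>Elements of the quandle as positive letters\<close>

definition embed_gen :: "'y \<times> 'x list \<Rightarrow> 'y \<times> ('x \<times> sign) list" where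
  "embed_gen b = (fst b, map (\<lambda>x. (x, Pos)) (snd b))"

lemma positive_form_embed [simp]: "positive_form (embed_gen b) = b" "parity (embed_gen b) = 1"
proof -
  have "foldl add_letter (r, []) (map (\<lambda>x. (x, Pos)) xs) = (r, xs)" for r xs
    by (induction xs rule: rev_induct) (auto simp: snoc_def)
  then show "positive_form (embed_gen b) = b" by (simp add: positive_form_def embed_gen_def)
  have "(\<Prod>l\<leftarrow>map (\<lambda>x. (x, Pos)) xs. if snd l = Pos then 1 else -1) = (1::int)" for xs :: "'x list"
    by (induction xs) auto
  then show "parity (embed_gen b) = 1" by (simp only: parity_def embed_gen_def snd_conv)
qed

lemma to_positive_embed: "to_positive (map_frag embed_gen c) = c"
  using subset_UNIV by (induction c rule: frag_induction) auto

lemma facesD_embed: "facesD (embed_gen b) = map_frag embed_gen (facesX b)"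
  unfolding faces_def embed_gen_def map_frag_def
  by (simp add: case_prod_unfold frag_extend_sum frag_extend_cmul frag_extend_diff comp_def
      take_map drop_map)

lemma embed_boundary: "frag_extend facesD (map_frag embed_gen c) = map_frag embed_gen (frag_extend facesX c)"
  using subset_UNIV
  by (induction c rule: frag_induction) (simp_all add: frag_extend_diff facesD_embed)

section \<open>The isomorphism of quotient complexes\<close>

abbreviation chainX where "chainX n \<equiv> chain_group X Y n"
abbreviation chainD where "chainD n \<equiv> chain_group (double X) Y n"
abbreviation SQ where "SQ n \<equiv> SQ_degen (double X) (double_op X qop) double_inv Y (double_act X qop act) n"
abbreviation bdX where "bdX n \<equiv> bdry X qop act n"
abbreviation bdD where "bdD n \<equiv> bdry (double X) (double_op X qop) double_set_act n"

lemma chain_basis_lists: "b \<in> chain_basis Z Y n \<Longrightarrow> b \<in> Y \<times> lists Z \<and> int (length (snd b)) = n \<and> n \<ge> 1"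
  by (auto simp: chain_basis_def lists_eq_set split: if_splits)

lemma chain_basisI: "\<lbrakk>b \<in> Y \<times> lists Z; int (length (snd b)) = n; n \<ge> 1\<rbrakk> \<Longrightarrow> b \<in> chain_basis Z Y n"
  by (auto simp: chain_basis_def lists_eq_set)

lemma chain_carrier: "c \<in> carrier (chain_group Z Y n) \<longleftrightarrow> Poly_Mapping.keys c \<subseteq> chain_basis Z Y n"
  by (simp add: chain_group_def)

lemma chain_comm_group: "comm_group (chain_group Z Y n)"
  unfolding chain_group_def by (rule abelian_free_Abelian_group)

lemma chain_group_is_group: "group (chain_group Z Y n)"
  unfolding chain_group_def by simp

lemma bdX_eq: "bdX n = (if n > 1 then frag_extend facesX else (\<lambda>_. 0))"
  by (simp add: bdry_faces gen_act_letter)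

lemma bdD_eq:
  assumes "Poly_Mapping.keys c \<subseteq> Y \<times> lists (double X)"
  shows "bdD n c = (if n > 1 then frag_extend facesD c else 0)"
proof -
  have "faces (gen_act (double X) (double_op X qop) double_set_act) (double_op X qop) b = facesD b"
    if "b \<in> Y \<times> lists (double X)" for b
  proof -
    have "gen_act (double X) (double_op X qop) double_set_act (fst b) l = letter_act (fst b) l"
      if "l \<in> set (snd b)" for l
      using \<open>b \<in> _\<close> that by (intro gen_act_double) (auto simp: in_lists_conv_set)
    then show ?thesis
      using faces_cong[of "snd b" "gen_act (double X) (double_op X qop) double_set_act" "fst b" letter_act]
      by simp
  qed
  then show ?thesis using assms by (auto simp: bdry_faces intro!: frag_extend_eq)
qed

lemma bdX_hom: "bdX n \<in> hom (chainX n) (chainX (n - 1))"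
proof (cases "n > 1")
  case True
  have "Poly_Mapping.keys (facesX b) \<subseteq> chain_basis X Y (n - 1)" if "b \<in> chain_basis X Y n" for b
  proof -
    note b = chain_basis_lists[OF that]
    have "Poly_Mapping.keys (facesX b) \<subseteq> {c \<in> Y \<times> lists X. length (snd c) = length (snd b) - 1}"
      by (rule keys_faces) (use b in \<open>auto simp: letter_act_closed closed\<close>)
    then show ?thesis using b True by (auto intro!: chain_basisI)
  qed
  then show ?thesis unfolding chain_group_def bdX_eq using True by (simp add: frag_extend_hom)
next
  case False
  then show ?thesis unfolding bdX_eq chain_group_def by (simp add: hom_def)
qed

lemma double_op_closed: "\<lbrakk>x \<in> double X; y \<in> double X\<rbrakk> \<Longrightarrow> double_op X qop x y \<in> double X"
  using quandle.closed[OF double_quandle] by blast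

lemma bdD_hom: "bdD n \<in> hom (chainD n) (chainD (n - 1))"
proof (cases "n > 1")
  case True
  let ?g = "gen_act (double X) (double_op X qop) double_set_act"
  have "Poly_Mapping.keys (faces ?g (double_op X qop) b) \<subseteq> chain_basis (double X) Y (n - 1)"
    if "b \<in> chain_basis (double X) Y n" for b
  proof -
    note b = chain_basis_lists[OF that]
    have "Poly_Mapping.keys (faces ?g (double_op X qop) b)
        \<subseteq> {c \<in> Y \<times> lists (double X). length (snd c) = length (snd b) - 1}"
      by (rule keys_faces) (use b in \<open>auto simp: gen_act_double double_op_closed\<close>, auto simp: double_def letter_act_closed)
    then show ?thesis using b True by (auto intro!: chain_basisI)
  qed
  then show ?thesis unfolding chain_group_def bdry_faces using True by (simp add: frag_extend_hom)
next
  case False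
  then show ?thesis unfolding bdry_faces chain_group_def by (simp add: hom_def)
qed

lemma degen_subgroup: "subgroup (degen Z Y n) (chain_group Z Y n)"
  unfolding degen_def chain_group_def
  by (rule group.generate_is_subgroup[OF group_free_Abelian_group]) auto

text \<open>
  In degree at most one the boundary is zero by convention; otherwise this is
  \<open>keys_facesX_degenerate\<close>.
\<close>

lemma bdX_degen: "bdX n ` degen X Y n \<subseteq> degen X Y (n - 1)"
proof (rule image_subsetI)
  fix c assume c: "c \<in> degen X Y n"
  then have "bdX n c \<in> carrier (chainX (n - 1))"
    using hom_in_carrier[OF bdX_hom] by (auto simp: degen_eq chain_carrier)
  moreover have "Poly_Mapping.keys (bdX n c) \<subseteq> {b. adjacent_equal (snd b)}"
  proof (cases "n > 1")
    case True
    have "Poly_Mapping.keys (facesX b) \<subseteq> {b. adjacent_equal (snd b)}" if "b \<in> Poly_Mapping.keys c" for b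
      by (rule keys_facesX_degenerate) (use c that in \<open>auto simp: degen_eq dest!: chain_basis_lists\<close>)
    then show ?thesis using True unfolding bdX_eq by (auto dest!: subsetD[OF keys_frag_extend])
  qed (simp add: bdX_eq)
  ultimately show "bdX n c \<in> degen X Y (n - 1)" by (auto simp: degen_eq chain_carrier)
qed

text \<open>
  The generator that the symmetric relation at position \<open>i\<close> pairs with \<open>b\<close>.
\<close>

definition flip_letter :: "nat \<Rightarrow> 'y \<times> ('x \<times> sign) list \<Rightarrow> 'y \<times> ('x \<times> sign) list" where
  "flip_letter i b = (letter_act (fst b) (snd b ! i),
     map (\<lambda>y. double_op X qop y (snd b ! i)) (take i (snd b)) @ [double_inv (snd b ! i)] @ drop (i + 1) (snd b))"

lemma flip_letter_closed:
  assumes "b \<in> chain_basis (double X) Y n" "i < length (snd b)"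
  shows "flip_letter i b \<in> chain_basis (double X) Y n"
proof -
  note b = chain_basis_lists[OF assms(1)]
  then have l: "\<forall>y\<in>set (snd b). y \<in> double X" and "fst b \<in> Y" by (auto simp: in_lists_conv_set)
  have i: "snd b ! i \<in> double X" using l assms(2) by simp
  then have "letter_act (fst b) (snd b ! i) \<in> Y" "double_inv (snd b ! i) \<in> double X"
    using \<open>fst b \<in> Y\<close> by (auto simp: double_def letter_act_closed)
  then show ?thesis
    using b assms(2) i l by (intro chain_basisI)
      (auto simp: flip_letter_def in_lists_conv_set double_op_closed dest: in_set_takeD in_set_dropD)
qed

lemma symm_degen_eq:
  "symm_degen (double X) (double_op X qop) double_inv Y double_set_act n =
    generate (chainD n) {frag_of b + frag_of (flip_letter i b) | b i.
      b \<in> chain_basis (double X) Y n \<and> i < length (snd b)}"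
proof -
  have *: "gen_act (double X) (double_op X qop) double_set_act r (ys ! i) = letter_act r (ys ! i)"
    if "(r, ys) \<in> chain_basis (double X) Y n" "i < length ys" for r ys i
  proof -
    have "ys ! i \<in> double X"
      using chain_basis_lists[OF that(1)] that(2) by (auto simp: in_lists_conv_set)
    then show ?thesis by (rule gen_act_double)
  qed
  show ?thesis
    unfolding symm_degen_def flip_letter_def split_paired_Ex fst_conv snd_conv
    by (intro arg_cong[where f = "generate (chainD n)"] Collect_cong ex_cong1 rev_conj_cong refl)
      (simp_all add: *)
qed

lemma symm_gens_subset:
  "{frag_of b + frag_of (flip_letter i b) | b i.
      b \<in> chain_basis (double X) Y n \<and> i < length (snd b)} \<subseteq> carrier (chainD n)"
proof -
  have "Poly_Mapping.keys (frag_of b + frag_of (flip_letter i b)) \<subseteq> chain_basis (double X) Y n"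
    if "b \<in> chain_basis (double X) Y n" "i < length (snd b)" for b i
    using keys_add[of "frag_of b" "frag_of (flip_letter i b)"] flip_letter_closed[OF that] that(1) by auto
  then show ?thesis by (auto simp: chain_carrier)
qed

lemma symm_degen_subgroup:
  "subgroup (symm_degen (double X) (double_op X qop) double_inv Y double_set_act n) (chainD n)"
  unfolding symm_degen_eq
  by (rule group.generate_is_subgroup[OF chain_group_is_group symm_gens_subset])

lemma SQ_subgroup: "subgroup (SQ n) (chainD n)"
  unfolding SQ_degen_def
  by (rule comm_group.mult_subgroups[OF chain_comm_group degen_subgroup symm_degen_subgroup])

lemma degen_SQ: "degen (double X) Y n \<subseteq> SQ n"
  and symm_degen_SQ: "symm_degen (double X) (double_op X qop) double_inv Y double_set_act n \<subseteq> SQ n"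
proof -
  have "0 \<in> degen (double X) Y n" "0 \<in> symm_degen (double X) (double_op X qop) double_inv Y double_set_act n"
    using subgroup.one_closed[OF degen_subgroup, of "double X" n] subgroup.one_closed[OF symm_degen_subgroup, of n]
    by (simp_all add: chain_group_def)
  then show "degen (double X) Y n \<subseteq> SQ n"
    "symm_degen (double X) (double_op X qop) double_inv Y double_set_act n \<subseteq> SQ n"
    unfolding SQ_degen_def set_mult_def chain_group_def by force+
qed

lemma embed_hom: "map_frag embed_gen \<in> hom (chainX n) (chainD n)"
proof -
  have "embed_gen b \<in> chain_basis (double X) Y n" if "b \<in> chain_basis X Y n" for b
    using chain_basis_lists[OF that]
    by (intro chain_basisI) (auto simp: embed_gen_def in_lists_conv_set double_def)
  then show ?thesis unfolding map_frag_def chain_group_def by (intro frag_extend_hom) auto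
qed

lemma embed_degen: "map_frag embed_gen ` degen X Y n \<subseteq> SQ n"
proof -
  have "map_frag embed_gen c \<in> degen (double X) Y n" if "c \<in> degen X Y n" for c
  proof -
    have "Poly_Mapping.keys (map_frag embed_gen c) \<subseteq> chain_basis (double X) Y n"
      using hom_in_carrier[OF embed_hom, of c n] that by (auto simp: chain_carrier degen_eq)
    moreover have "Poly_Mapping.keys (map_frag embed_gen c) \<subseteq> {b. adjacent_equal (snd b)}"
      using that by (auto simp: degen_eq embed_gen_def adjacent_equal_map dest!: subsetD[OF keys_map_frag])
    ultimately show ?thesis by (auto simp: degen_eq)
  qed
  then show ?thesis using degen_SQ by blast
qed

lemma to_positive_hom: "to_positive \<in> hom (chainD n) (chainX n)"
proof -
  have "positive_form b \<in> chain_basis X Y n" if "b \<in> chain_basis (double X) Y n" for b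
    using chain_basis_lists[OF that] positive_form_basis[of b] by (intro chain_basisI) auto
  then show ?thesis unfolding to_positive_def chain_group_def by (intro frag_extend_hom) auto
qed

text \<open>
  Two equal negative letters \<open>x, x\<close> at the end become \<open>x * x\<^sup>-\<^sup>1, x\<close>, and the first of these is \<open>x\<close> again.
  Later letters act on both alike.
\<close>

lemma adjacent_equal_positive_form:
  assumes "b \<in> Y \<times> lists (double X)" "adjacent_equal (snd b)"
  shows "adjacent_equal (snd (positive_form b))"
  using assms
proof (induction rule: basis_induct)
  case (Nil r)
  then show ?case by simp
next
  case (snoc b l)
  obtain x e where l: "l = (x, e)" "x \<in> X" using snoc(2) by (auto simp: double_def)
  from snoc.prems consider "adjacent_equal (snd b)" | zs where "snd b = zs @ [l]"
    by (auto simp: snoc_def adjacent_equal_snoc)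
  then show ?case
  proof cases
    case 1
    then show ?thesis
      using snoc.IH unfolding l(1) positive_form_simps
      by (cases e) (auto simp: snoc_def push_def adjacent_equal_snoc adjacent_equal_map)
  next
    case 2
    define a where "a = (fst b, zs)"
    have b: "b = snoc l a" using 2 by (cases b) (simp add: a_def snoc_def)
    have x: "signed_op X qop x x Neg = x"
      using Q1[OF l(2)] qop_inv_eqI[OF l(2) l(2)] by simp
    have "adjacent_equal (snd (snoc x (snoc x c)))" for c :: "'y \<times> 'x list"
      using adjacent_equal_snoc[of "snd c @ [x]" x] by (simp add: snoc_def)
    then show ?thesis
      by (cases e) (simp_all only: b l positive_form_simps add_letter.simps push_snoc x)
  qed
qed

text \<open>
  If \<open>e\<close> is positive, \<open>x\<close> acts on the preceding letters when it is flipped, and its inverse acts on them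
  when the flipped letter is made positive, so they come back to what they were. If \<open>e\<close> is negative, the
  inverse of \<open>x\<close> acts exactly once on both sides: in making \<open>x\<close> positive on the left, in flipping it on
  the right. Hence the positive forms agree, while the parities are opposite.
\<close>

lemma to_positive_flip:
  assumes "r \<in> Y" "set us \<subseteq> double X" "x \<in> X" "set vs \<subseteq> double X"
  shows "to_positive (frag_of (r, us @ [(x, e)] @ vs)
     + frag_of (letter_act r (x, e), map (\<lambda>y. double_op X qop y (x, e)) us @ [(x, flip e)] @ vs)) = 0"
proof -
  let ?b = "(r, us)"
  have b: "?b \<in> Y \<times> lists (double X)" using assms by (auto simp: lists_eq_set)
  note p = positive_form_closed[OF b]
  have "add_letter (positive_form (pushD (x, e) ?b)) (x, flip e) = add_letter (positive_form ?b) (x, e)"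
    using positive_form_pushD[OF b assms(3), of e] push_flip[OF p assms(3), of Pos]
    by (cases e) simp_all
  then have pf: "positive_form (letter_act r (x, e), map (\<lambda>y. double_op X qop y (x, e)) us @ [(x, flip e)] @ vs)
      = positive_form (r, us @ [(x, e)] @ vs)"
    by (simp add: positive_form_def pushD_def)
  have "parity (pushD (x, e) ?b) = parity ?b" by simp
  then have "parity (letter_act r (x, e), map (\<lambda>y. double_op X qop y (x, e)) us @ [(x, flip e)] @ vs)
      = - parity (r, us @ [(x, e)] @ vs)"
    by (cases e) (simp_all add: parity_def pushD_def)
  then show ?thesis by (simp only: to_positive_simps pf flip: frag_cmul_distrib) simp
qed

lemma to_positive_flip_letter:
  assumes "b \<in> chain_basis (double X) Y n" "i < length (snd b)"
  shows "to_positive (frag_of b + frag_of (flip_letter i b)) = 0"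
proof -
  obtain r ys where b: "b = (r, ys)" "r \<in> Y" "set ys \<subseteq> double X"
    using chain_basis_lists[OF assms(1)] by (auto simp: lists_eq_set)
  have ys: "ys = take i ys @ [ys ! i] @ drop (i + 1) ys"
    using assms(2) b(1) id_take_nth_drop[of i ys] by simp
  have "ys ! i \<in> double X" using subsetD[OF b(3) nth_mem] assms(2) b(1) by simp
  then obtain x e where x: "ys ! i = (x, e)" "x \<in> X" by (auto simp: double_def)
  have "set (take i ys) \<subseteq> double X" "set (drop (i + 1) ys) \<subseteq> double X"
    using order_trans[OF set_take_subset b(3)] order_trans[OF set_drop_subset b(3)] by auto
  then show ?thesis
    using to_positive_flip[of r "take i ys" x "drop (i + 1) ys" e] b(2) x ys
    by (simp add: b(1) flip_letter_def)
qed

lemma to_positive_SQ: "to_positive ` SQ n \<subseteq> degen X Y n"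
proof -
  let ?D = "degen X Y n"
  interpret group_hom "chainD n" "chainX n" to_positive
    using to_positive_hom by (simp add: group_hom_def group_hom_axioms_def chain_group_is_group)
  have "to_positive ` degen (double X) Y n \<subseteq> ?D"
    unfolding degen_generators[of "double X"]
  proof (rule generate_into_subgroup[OF _ degen_subgroup])
    show "to_positive ` frag_of ` {b \<in> chain_basis (double X) Y n. adjacent_equal (snd b)} \<subseteq> ?D"
    proof clarify
      fix r ys assume b: "(r, ys) \<in> chain_basis (double X) Y n" "adjacent_equal (snd (r, ys))"
      have "positive_form (r, ys) \<in> chain_basis X Y n"
        using chain_basis_lists[OF b(1)] positive_form_basis[of "(r, ys)"] by (intro chain_basisI) auto
      moreover have "adjacent_equal (snd (positive_form (r, ys)))"
        using adjacent_equal_positive_form b chain_basis_lists[OF b(1)] by blast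
      ultimately show "to_positive (frag_of (r, ys)) \<in> ?D" by (auto simp: degen_eq)
    qed
  qed (auto simp: chain_carrier)
  moreover have "to_positive ` symm_degen (double X) (double_op X qop) double_inv Y double_set_act n \<subseteq> ?D"
    unfolding symm_degen_eq
  proof (rule generate_into_subgroup[OF symm_gens_subset degen_subgroup])
    have "0 \<in> ?D" by (simp add: degen_eq)
    then show "to_positive ` {frag_of b + frag_of (flip_letter i b) | b i.
      b \<in> chain_basis (double X) Y n \<and> i < length (snd b)} \<subseteq> ?D"
      using to_positive_flip_letter[of _ n] by fastforce
  qed
  moreover have "to_positive (a + c) \<in> ?D" if "to_positive a \<in> ?D" "to_positive c \<in> ?D" for a c
    using subgroup.m_closed[OF degen_subgroup that] by (simp add: chain_group_def)
  ultimately show ?thesis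
    unfolding SQ_degen_def set_mult_def by (auto simp: chain_group_def image_subset_iff)
qed

text \<open>
  Induction on the number of negative letters. Flipping one of them gives a generator with fewer
  negative letters that is, modulo the relations, the negative of \<open>b\<close>; by \<open>to_positive_flip_letter\<close> the
  positive forms are negatives of each other as well. A generator without negative letters is in the
  image of the embedding, where the claim is exact.
\<close>

lemma embed_to_positive_generator_mod_SQ:
  assumes "b \<in> chain_basis (double X) Y n"
  shows "frag_of b - map_frag embed_gen (to_positive (frag_of b)) \<in> SQ n"
  using assms
proof (induction "length (filter (\<lambda>l. snd l = Neg) (snd b))" arbitrary: b rule: less_induct)
  case less
  show ?case
  proof (cases "\<exists>l\<in>set (snd b). snd l = Neg")
    case False
    have "(l, Pos) = l'" if "l' \<in> set (snd b)" "l = fst l'" for l l'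
      using False that by (cases l'; cases "snd l'") auto
    then have "embed_gen (fst b, map fst (snd b)) = b"
      by (cases b) (auto simp: embed_gen_def intro!: map_idI)
    then have "map_frag embed_gen (to_positive (frag_of b)) = frag_of b"
      using to_positive_embed[of "frag_of (fst b, map fst (snd b))"] by simp
    then show ?thesis using subgroup.one_closed[OF SQ_subgroup, of n] by (simp add: chain_group_def)
  next
    case True
    then obtain i where i: "i < length (snd b)" "snd (snd b ! i) = Neg" by (auto simp: in_set_conv_nth)
    let ?b = "flip_letter i b"
    have split: "snd b = take i (snd b) @ [snd b ! i] @ drop (i + 1) (snd b)"
      using i(1) id_take_nth_drop[of i "snd b"] by simp
    have sgn: "snd (double_op X qop y l) = snd y" for y l by (cases y; cases l) simp
    have inv: "snd (double_inv (snd b ! i)) = Pos" using i(2) by (cases "snd b ! i") simp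
    have "length (filter (\<lambda>l. snd l = Neg) (snd ?b)) < length (filter (\<lambda>l. snd l = Neg) (snd b))"
    proof -
      define us vs l where "us = take i (snd b)" and "vs = drop (i + 1) (snd b)" and "l = snd b ! i"
      have "snd b = us @ [l] @ vs" using split by (simp only: us_def vs_def l_def)
      moreover have "snd ?b = map (\<lambda>y. double_op X qop y l) us @ [double_inv l] @ vs"
        by (simp only: flip_letter_def us_def vs_def l_def snd_conv)
      moreover have "snd l = Neg" "snd (double_inv l) = Pos" using inv i(2) by (simp_all only: l_def)
      ultimately show ?thesis by (simp add: filter_map comp_def sgn)
    qed
    from less.hyps[OF this flip_letter_closed[OF less.prems i(1)]]
    have IH: "frag_of ?b - map_frag embed_gen (to_positive (frag_of ?b)) \<in> SQ n" .
    have "frag_of b + frag_of ?b \<in> SQ n"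
      using less.prems i(1) by (intro subsetD[OF symm_degen_SQ]) (unfold symm_degen_eq, blast intro: generate.incl)
    then have "(frag_of b + frag_of ?b) - (frag_of ?b - map_frag embed_gen (to_positive (frag_of ?b))) \<in> SQ n"
      using free_Abelian_subgroup_diff IH SQ_subgroup[of n] unfolding chain_group_def by blast
    moreover have "map_frag embed_gen (to_positive (frag_of b)) = - map_frag embed_gen (to_positive (frag_of ?b))"
      using arg_cong[OF to_positive_flip_letter[OF less.prems i(1)], of "map_frag embed_gen"]
      by (simp add: eq_neg_iff_add_eq_0 del: minus_frag_cmul)
    ultimately show ?thesis by simp
  qed
qed

lemma embed_to_positive_mod_SQ:
  assumes "c \<in> carrier (chainD n)"
  shows "c - map_frag embed_gen (to_positive c) \<in> SQ n"
proof -
  have "Poly_Mapping.keys c \<subseteq> chain_basis (double X) Y n" using assms by (simp add: chain_carrier)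
  then show ?thesis
  proof (induction c rule: frag_induction)
    case zero
    then show ?case using subgroup.one_closed[OF SQ_subgroup, of n] by (simp add: chain_group_def)
  next
    case (one b)
    then show ?case by (rule embed_to_positive_generator_mod_SQ)
  next
    case (diff a b)
    then have "(a - map_frag embed_gen (to_positive a)) - (b - map_frag embed_gen (to_positive b)) \<in> SQ n"
      using free_Abelian_subgroup_diff SQ_subgroup[of n] unfolding chain_group_def by blast
    then show ?case by (simp add: algebra_simps)
  qed
qed

lemma to_positive_bdry:
  assumes "c \<in> carrier (chainD n)"
  shows "to_positive (bdD n c) = bdX n (to_positive c)"
proof -
  have "Poly_Mapping.keys c \<subseteq> Y \<times> lists (double X)"
    using assms chain_basis_lists unfolding chain_carrier by blast
  then show ?thesis by (simp add: bdD_eq bdX_eq to_positive_boundary)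
qed

lemma embed_bdry:
  assumes "c \<in> carrier (chainX n)"
  shows "map_frag embed_gen (bdX n c) = bdD n (map_frag embed_gen c)"
proof -
  have "Poly_Mapping.keys (map_frag embed_gen c) \<subseteq> Y \<times> lists (double X)"
    using hom_in_carrier[OF embed_hom assms] chain_basis_lists unfolding chain_carrier by blast
  then show ?thesis by (simp add: bdD_eq bdX_eq embed_boundary)
qed

text \<open>
  For \<open>c\<close> in the subgroup divided out, the positive form of its boundary is the boundary of a degenerate
  chain over \<open>X\<close>, hence degenerate. Embedding it again gives an element of the subgroup, from which the
  boundary of \<open>c\<close> differs by another such element.
\<close>

lemma bdD_SQ: "bdD n ` SQ n \<subseteq> SQ (n - 1)"
proof (rule image_subsetI)
  fix c assume c: "c \<in> SQ n"
  then have car: "c \<in> carrier (chainD n)" by (rule subgroup.mem_carrier[OF SQ_subgroup])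
  have "to_positive (bdD n c) \<in> degen X Y (n - 1)"
    unfolding to_positive_bdry[OF car] using c to_positive_SQ bdX_degen by blast
  then have "map_frag embed_gen (to_positive (bdD n c)) \<in> SQ (n - 1)"
    using embed_degen by blast
  from subgroup.m_closed[OF SQ_subgroup embed_to_positive_mod_SQ[OF hom_in_carrier[OF bdD_hom car]] this]
  show "bdD n c \<in> SQ (n - 1)" by (simp add: chain_group_def)
qed

abbreviation embed_quot where "embed_quot n \<equiv> quot_map (chainD n) (SQ n) (map_frag embed_gen)"
abbreviation CSQD where "CSQD \<equiv> CSQ (double X) (double_op X qop) double_inv Y (double_act X qop act)"
abbreviation bdSQD where "bdSQD \<equiv> bdrySQ (double X) (double_op X qop) double_inv Y (double_act X qop act)"

lemma embed_isomorphisms: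
  "group_isomorphisms (CQ X Y n) (CSQD n) (embed_quot n) (quot_map (chainX n) (degen X Y n) to_positive)"
  unfolding CQ_def CSQ_def
proof (rule quot_map_isomorphisms[OF chain_comm_group chain_comm_group degen_subgroup SQ_subgroup
      embed_hom embed_degen to_positive_hom to_positive_SQ])
  fix c assume c: "c \<in> carrier (chainD n)"
  let ?c = "map_frag embed_gen (to_positive c)"
  have "SQ n #>\<^bsub>chainD n\<^esub> ((c - ?c) \<otimes>\<^bsub>chainD n\<^esub> ?c) = SQ n #>\<^bsub>chainD n\<^esub> ?c"
    by (rule coset_absorb[OF chain_group_is_group SQ_subgroup embed_to_positive_mod_SQ[OF c]
          hom_in_carrier[OF embed_hom hom_in_carrier[OF to_positive_hom c]]])
  then show "SQ n #>\<^bsub>chainD n\<^esub> ?c = SQ n #>\<^bsub>chainD n\<^esub> c" by (simp add: chain_group_def)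
qed (simp add: to_positive_embed)

lemma bdryQ_hom: "bdryQ X qop Y act n \<in> hom (CQ X Y n) (CQ X Y (n - 1))"
  unfolding bdryQ_def CQ_def
  by (rule quot_map_hom[OF chain_comm_group chain_comm_group degen_subgroup degen_subgroup bdX_hom bdX_degen])

lemma embed_quot_boundary:
  assumes "K \<in> carrier (CQ X Y n)"
  shows "embed_quot (n - 1) (bdryQ X qop Y act n K) = bdSQD n (embed_quot n K)"
proof -
  note quot_map_coset' = quot_map_coset[OF chain_comm_group chain_comm_group]
  obtain c where c: "c \<in> carrier (chainX n)" "K = degen X Y n #>\<^bsub>chainX n\<^esub> c"
    using assms unfolding CQ_def carrier_FactGroup by blast
  have "embed_quot (n - 1) (bdryQ X qop Y act n K)
      = SQ (n - 1) #>\<^bsub>chainD (n - 1)\<^esub> map_frag embed_gen (bdX n c)"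
    unfolding c(2) bdryQ_def quot_map_coset'[OF degen_subgroup degen_subgroup bdX_hom bdX_degen c(1)]
    by (rule quot_map_coset'[OF degen_subgroup SQ_subgroup embed_hom embed_degen
          hom_in_carrier[OF bdX_hom c(1)]])
  also have "\<dots> = SQ (n - 1) #>\<^bsub>chainD (n - 1)\<^esub> bdD n (map_frag embed_gen c)"
    by (simp only: embed_bdry[OF c(1)])
  also have "\<dots> = bdSQD n (embed_quot n K)"
    unfolding c(2) bdrySQ_def quot_map_coset'[OF degen_subgroup SQ_subgroup embed_hom embed_degen c(1)]
    by (rule quot_map_coset'[OF SQ_subgroup SQ_subgroup bdD_hom bdD_SQ
          hom_in_carrier[OF embed_hom c(1)], symmetric])
  finally show ?thesis .
qed

lemma quotient_monoids: "monoid (CQ X Y n)" "monoid (CSQD n)"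
  unfolding CQ_def CSQ_def
  using comm_group.abelian_FactGroup[OF chain_comm_group degen_subgroup, of X n]
    comm_group.abelian_FactGroup[OF chain_comm_group SQ_subgroup, of n]
  by (simp_all add: comm_group_def group_def)

end

theorem theorem4p11:
  fixes X :: "'x set" and qop :: "'x \<Rightarrow> 'x \<Rightarrow> 'x"
    and Y :: "'y set" and act :: "'y \<Rightarrow> 'x word set \<Rightarrow> 'y"
    and A :: "('a, 'm) monoid_scheme" and n :: int
  assumes "quandle X qop"
    and "quandle_set X qop Y act"
    and "comm_group A"
  shows "HQ_lower X qop Y act A n
      \<cong> HSQ_lower (double X) (double_op X qop) double_inv Y (double_act X qop act) A n
    \<and> HQ_upper X qop Y act A n
      \<cong> HSQ_upper (double X) (double_op X qop) double_inv Y (double_act X qop act) A n"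
proof -
  interpret quandle_action X qop Y act
    using assms(1,2) by (simp add: quandle_action_def quandle_action_axioms_def)
  have A: "monoid A" using assms(3) by (simp add: comm_group_def group_def)
  show ?thesis
    unfolding HQ_lower_def HSQ_lower_def HQ_upper_def HSQ_upper_def
  proof
    show "homology_coeff (CQ X Y) (bdryQ X qop Y act) A n \<cong> homology_coeff CSQD bdSQD A n"
      by (rule homology_coeff_iso[where f = embed_quot])
        (fact quotient_monoids A bdryQ_hom embed_quot_boundary
          group_isomorphisms_imp_iso[OF embed_isomorphisms])+
    show "cohomology_coeff (CQ X Y) (bdryQ X qop Y act) A n \<cong> cohomology_coeff CSQD bdSQD A n"
      by (rule cohomology_coeff_iso[where f = embed_quot])
        (fact quotient_monoids assms(3) bdryQ_hom embed_quot_boundary embed_isomorphisms)+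
  qed
qed

end
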